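(* Let $G_1,\dots,G_n$ be finitely generated non-elementary virtually free groups. Then $G_1\times\cdots\times G_n$ has the $R_\infty$-property.
   Context: A group is non-elementary virtually free if it contains a non-abelian free subgroup of finite index. A group $A$ has the $R_\infty$-property if every automorphism $\psi$ of $A$ has infinitely many $\psi$-conjugacy classes, where $x,y$ are $\psi$-conjugate if $x=gy\psi(g)^{-1}$ for some $g\in A$. *)

theory Defs
  imports "HOL-Algebra.Algebra"
begin

definition word_eval :: "('a, 'b) monoid_scheme \<Rightarrow> (bool \<times> 'a) list \<Rightarrow> 'a" where
  "word_eval G w = foldr (\<lambda>(e, x) acc. (if e then x else inv\<^bsub>G\<^esub> x) \<otimes>\<^bsub>G\<^esub> acc) w \<one>\<^bsub>G\<^esub>"

definition reduced_word :: "'a set \<Rightarrow> (bool \<times> 'a) list \<Rightarrow> bool" where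
  "reduced_word S w \<longleftrightarrow> set (map snd w) \<subseteq> S \<and>
     (\<forall>i. Suc i < length w \<longrightarrow> \<not> (snd (w ! i) = snd (w ! Suc i) \<and> fst (w ! i) \<noteq> fst (w ! Suc i)))"

definition free_basis :: "('a, 'b) monoid_scheme \<Rightarrow> 'a set \<Rightarrow> bool" where
  "free_basis F S \<longleftrightarrow> S \<subseteq> carrier F \<and> generate F S = carrier F \<and>
     (\<forall>w. reduced_word S w \<and> w \<noteq> [] \<longrightarrow> word_eval F w \<noteq> \<one>\<^bsub>F\<^esub>)"

definition nonabelian_free_subgroup :: "'a set \<Rightarrow> ('a, 'b) monoid_scheme \<Rightarrow> bool" where
  "nonabelian_free_subgroup H G \<longleftrightarrow> subgroup H G \<and>
     (\<exists>S. free_basis (G\<lparr>carrier := H\<rparr>) S \<and> (\<exists>a\<in>S. \<exists>b\<in>S. a \<noteq> b))"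

definition non_elementary_virtually_free :: "('a, 'b) monoid_scheme \<Rightarrow> bool" where
  "non_elementary_virtually_free G \<longleftrightarrow> group G \<and>
     (\<exists>H. nonabelian_free_subgroup H G \<and> finite (rcosets\<^bsub>G\<^esub> H))"

definition finitely_generated_group :: "('a, 'b) monoid_scheme \<Rightarrow> bool" where
  "finitely_generated_group G \<longleftrightarrow> group G \<and>
     (\<exists>A. finite A \<and> A \<subseteq> carrier G \<and> generate G A = carrier G)"

definition twisted_conj :: "('a, 'b) monoid_scheme \<Rightarrow> ('a \<Rightarrow> 'a) \<Rightarrow> ('a \<times> 'a) set" where
  "twisted_conj A \<psi> = {(x, y). x \<in> carrier A \<and> y \<in> carrier A \<and>
     (\<exists>g\<in>carrier A. x = g \<otimes>\<^bsub>A\<^esub> y \<otimes>\<^bsub>A\<^esub> inv\<^bsub>A\<^esub> (\<psi> g))}"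

definition R_infinity :: "('a, 'b) monoid_scheme \<Rightarrow> bool" where
  "R_infinity A \<longleftrightarrow> (\<forall>\<psi>\<in>iso A A. infinite (carrier A // twisted_conj A \<psi>))"

end

theory Submission
  imports Defs
begin

text \<open>
  A nonabelian free group maps onto every alternating group of odd degree. Composing with the
  projection to the first factor, a finite-index subgroup \<open>L\<close> of the product maps onto \<open>Alt(q + 2)\<close> for
  every odd prime \<open>q\<close>. Given an automorphism \<open>\<psi>\<close>, finite generation yields a \<open>\<psi>\<close>-invariant normal subgroup
  \<open>K \<subseteq> L\<close> of finite index; by simplicity \<open>K\<close> still maps onto \<open>T = Alt(q + 2)\<close> via some \<open>\<rho>\<close> once \<open>q\<close> exceeds
  the index. The kernel of \<open>\<rho>\<close> is \<open>\<psi>\<close>-periodic, say with least period \<open>c\<close>, so \<open>\<rho> \<circ> \<psi>\<^sup>c = \<alpha> \<circ> \<rho>\<close> for an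
  automorphism \<open>\<alpha>\<close> of \<open>T\<close>, and \<open>x \<mapsto> \<rho>(x) \<rho>(\<psi> x) \<dots> \<rho>(\<psi>\<^bsup>c-1\<^esup> x)\<close> sends \<open>\<psi>\<close>-conjugate elements to
  \<open>\<alpha>\<close>-conjugate ones. All elements of order \<open>q\<close> are conjugate in \<open>T\<close>, so \<open>\<alpha>\<close> composed with an inner
  automorphism has a nontrivial fixed point, which forces at least two \<open>\<alpha>\<close>-conjugacy classes.
  The simple quotients \<open>\<rho> \<circ> \<psi>\<^sup>i\<close>, over finitely many primes \<open>q\<close> and all \<open>i < c\<close>, have pairwise distinct
  kernels and are therefore jointly surjective. This makes the choices for different \<open>q\<close> independent
  and produces arbitrarily many \<open>\<psi>\<close>-conjugacy classes.
\<close>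

section \<open>Alternating groups\<close>

lemma cycle_in_alt_group:
  assumes "distinct cs" "odd (length cs)" "set cs \<subseteq> {1..n}"
  shows "cycle_of_list cs \<in> carrier (alt_group n)"
proof -
  have "swapidseq (length cs - 1) (cycle_of_list cs)"
    using swapidseq_ext_imp_swapidseq[OF swapidseq_ext_of_cycles[OF assms(1)]] .
  then have "evenperm (cycle_of_list cs)"
    using assms(2) by (simp add: evenperm_unique)
  then show ?thesis
    using permutes_subset[OF cycle_permutes assms(3)] by (simp add: alt_group_carrier)
qed

text \<open>Both lists are completed to enumerations of \<open>{1..n}\<close> and matched entry by
  entry. If the resulting permutation is odd, a transposition of two points outside
  \<open>ys\<close> corrects the sign; \<open>length ys + 2 \<le> n\<close> provides these
  points.\<close>

lemma alt_group_map_list: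
  assumes xs: "distinct xs" "set xs \<subseteq> {1..n}" and ys: "distinct ys" "set ys \<subseteq> {1..n}"
    and len: "length xs = length ys" "length ys + 2 \<le> n"
  obtains s where "s \<in> carrier (alt_group n)" "map s xs = ys"
proof -
  obtain xs2 where xs2: "set xs2 = {1..n} - set xs" "distinct xs2"
    using finite_distinct_list[of "{1..n} - set xs"] by auto
  obtain ys2 where ys2: "set ys2 = {1..n} - set ys" "distinct ys2"
    using finite_distinct_list[of "{1..n} - set ys"] by auto
  define zs ws where "zs = xs @ xs2" and "ws = ys @ ys2"
  have zs: "distinct zs" "set zs = {1..n}" and ws: "distinct ws" "set ws = {1..n}"
    using xs ys xs2 ys2 by (auto simp: zs_def ws_def)
  have lz: "length zs = n" and lw: "length ws = n"
    using distinct_card[OF zs(1)] distinct_card[OF ws(1)] zs(2) ws(2) by auto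
  have bz: "bij_betw (nth zs) {..<n} {1..n}" and bw: "bij_betw (nth ws) {..<n} {1..n}"
    using bij_betw_nth[OF zs(1)] bij_betw_nth[OF ws(1)] zs ws lz lw by auto
  define s0 where "s0 = nth ws \<circ> inv_into {..<n} (nth zs)"
  define s where "s = (\<lambda>x. if x \<in> {1..n} then s0 x else x)"
  have "bij_betw s0 {1..n} {1..n}"
    unfolding s0_def using bij_betw_trans[OF bij_betw_inv_into[OF bz] bw] .
  then have "bij_betw s {1..n} {1..n}"
    using bij_betw_cong[of "{1..n}" s0 s] by (simp add: s_def)
  then have s: "s permutes {1..n}"
    by (rule bij_imp_permutes) (auto simp: s_def)
  have snth: "s (zs ! i) = ws ! i" if "i < n" for i
  proof -
    have "zs ! i \<in> {1..n}"
      using that lz zs(2) nth_mem by blast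
    moreover have "inv_into {..<n} (nth zs) (zs ! i) = i"
      using bz that by (simp add: bij_betw_def inv_into_f_f)
    ultimately show ?thesis
      by (simp add: s_def s0_def)
  qed
  have maps: "map s xs = ys"
  proof (rule nth_equalityI)
    fix i assume "i < length (map s xs)"
    then have i: "i < length xs" "i < n"
      using len by auto
    then show "map s xs ! i = ys ! i"
      using snth[of i] len by (simp add: zs_def ws_def nth_append)
  qed (use len in simp)
  have l2: "length ys2 \<ge> 2"
    using lw len by (simp add: ws_def)
  then obtain u v zs2 where uv2: "ys2 = u # v # zs2"
    by (auto simp: numeral_2_eq_2 Suc_le_length_iff)
  have uv: "u \<noteq> v" "u \<in> {1..n} - set ys" "v \<in> {1..n} - set ys"
    unfolding ys2(1)[symmetric] using ys2(2) by (simp_all add: uv2)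
  show thesis
  proof (cases "evenperm s")
    case True
    then show ?thesis
      using that s maps by (simp add: alt_group_carrier)
  next
    case False
    define t where "t = transpose u v \<circ> s"
    have t: "t permutes {1..n}"
      unfolding t_def using permutes_compose[OF s permutes_swap_id] uv by auto
    have "permutation s"
      using s permutation_permutes by blast
    then have "evenperm t"
      unfolding t_def using False uv by (simp add: evenperm_comp permutation_swap_id evenperm_swap)
    moreover have "map t xs = ys"
    proof -
      have "map t xs = map (transpose u v) (map s xs)"
        by (simp add: t_def)
      also have "\<dots> = map (transpose u v) ys"
        by (simp only: maps)
      also have "\<dots> = ys"
        using uv by (intro map_idI) (auto simp: transpose_def)
      finally show ?thesis .
    qed
    ultimately show ?thesis
      using that t by (simp add: alt_group_carrier)
  qed
qed

lemma alt_group_cycles_conjugate: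
  assumes "distinct xs" "set xs \<subseteq> {1..n}" "distinct ys" "set ys \<subseteq> {1..n}"
    and "length xs = length ys" "length ys + 2 \<le> n"
  obtains s where "s \<in> carrier (alt_group n)" "s \<circ> cycle_of_list xs \<circ> inv' s = cycle_of_list ys"
proof -
  obtain s where s: "s \<in> carrier (alt_group n)" "map s xs = ys"
    using alt_group_map_list[OF assms] .
  then have "bij s"
    using alt_group_carrier' permutation_bijective by blast
  then show ?thesis
    using that s conjugation_of_cycle[OF assms(1)] by metis
qed

section \<open>Simplicity of the alternating groups of degree at least 5\<close>

lemma cycle3_apply:
  assumes "distinct [a, b, c]"
  shows "cycle_of_list [a, b, c] x = (if x = a then b else if x = b then c else if x = c then a else x)"
  using assms by (auto simp: transpose_def)

text \<open>For n \<ge> 5 three points leave two more free, so all 3-cycles are conjugate inside the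
  alternating group, and they generate it.\<close>

lemma alt_group_normal_three_cycle:
  assumes N: "N \<lhd> alt_group n" and n: "n \<ge> 5"
    and abc: "distinct [a, b, c]" "{a, b, c} \<subseteq> {1..n}" and mem: "cycle_of_list [a, b, c] \<in> N"
  shows "N = carrier (alt_group n)"
proof -
  interpret normal N "alt_group n" by (rule N)
  have "three_cycles n \<subseteq> N"
  proof
    fix p assume "p \<in> three_cycles n"
    then obtain cs where cs: "p = cycle_of_list cs" "distinct cs" "length cs = 3" "set cs \<subseteq> {1..n}"
      by auto
    have "distinct [a, b, c]" "set [a, b, c] \<subseteq> {1..n}" "length [a, b, c] = length cs"
      "length cs + 2 \<le> n"
      using abc cs n by auto
    then obtain s where s: "s \<in> carrier (alt_group n)"
      "s \<circ> cycle_of_list [a, b, c] \<circ> inv' s = p"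
      using alt_group_cycles_conjugate[of "[a, b, c]" n cs] cs by metis
    then show "p \<in> N"
      using inv_op_closed2[OF s(1) mem] by (simp add: alt_group_mult alt_group_inv_equality comp_assoc)
  qed
  then have "generate (alt_group n) (three_cycles n) \<subseteq> N"
    by (rule generate_subgroup_incl) (rule subgroup_axioms)
  then show ?thesis
    using alt_group_carrier_as_three_cycles[of n] subset by auto
qed

lemma three_cycle_commutator:
  assumes "bij p" "distinct [a, b, c]"
  shows "p \<circ> (cycle_of_list [a, b, c] \<circ> inv' p \<circ> inv' (cycle_of_list [a, b, c])) =
    cycle_of_list [p a, p b, p c] \<circ> cycle_of_list [c, b, a]"
proof -
  have "bij (cycle_of_list [a, b, c])"
    using permutation_bijective permutation_of_cycle by blast
  moreover have "cycle_of_list [a, b, c] \<circ> cycle_of_list [c, b, a] = id"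
    using assms(2) by (auto simp: transpose_def fun_eq_iff)
  ultimately have "inv' (cycle_of_list [a, b, c]) = cycle_of_list [c, b, a]"
    using assms(2) by (metis comp_assoc fun.map_id0 id_apply inv_o_cancel bij_is_inj comp_id id_comp)
  moreover have "p \<circ> cycle_of_list [a, b, c] \<circ> inv' p = cycle_of_list [p a, p b, p c]"
    using conjugation_of_cycle[OF assms(2,1)] by simp
  ultimately show ?thesis
    by (metis comp_assoc)
qed

text \<open>The element is the commutator of \<open>p\<close> with \<open>t = (a b c)\<close>, that
  is, \<open>p\<close> times a conjugate of its inverse. It moves at most six points, however many
  \<open>p\<close> moves, which is how 3-cycles are reached below.\<close>

lemma alt_group_normal_commutator:
  assumes N: "N \<lhd> alt_group n" and p: "p \<in> N"
    and abc: "distinct [a, b, c]" "{a, b, c} \<subseteq> {1..n}"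
  shows "cycle_of_list [p a, p b, p c] \<circ> cycle_of_list [c, b, a] \<in> N"
proof -
  interpret normal N "alt_group n" by (rule N)
  have t: "cycle_of_list [a, b, c] \<in> carrier (alt_group n)"
    using abc by (intro cycle_in_alt_group) auto
  have pA: "p \<in> carrier (alt_group n)"
    using p subset by auto
  then have bp: "bij p"
    using alt_group_carrier' permutation_bijective by blast
  have "p \<otimes>\<^bsub>alt_group n\<^esub> (cycle_of_list [a, b, c] \<otimes>\<^bsub>alt_group n\<^esub> inv\<^bsub>alt_group n\<^esub> p
      \<otimes>\<^bsub>alt_group n\<^esub> inv\<^bsub>alt_group n\<^esub> cycle_of_list [a, b, c]) \<in> N"
    by (rule subgroup.m_closed[OF subgroup_axioms p inv_op_closed2[OF t m_inv_closed[OF p]]])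
  then show ?thesis
    unfolding alt_group_inv_equality[OF t] alt_group_inv_equality[OF pA] alt_group_mult
      three_cycle_commutator[OF bp abc(1)] .
qed

text \<open>With \<open>b = p a\<close>, \<open>c = p b\<close>, \<open>d = p c\<close>, the
  commutator of \<open>p\<close> with \<open>(a b c)\<close> is the 3-cycle
  \<open>(a d b)\<close>.\<close>

lemma alt_group_normal_long_cycle:
  assumes N: "N \<lhd> alt_group n" and n: "n \<ge> 5" and p: "p \<in> N" and a: "a \<in> {1..n}"
    and d: "distinct [a, p a, p (p a), p (p (p a))]"
  shows "N = carrier (alt_group n)"
proof -
  interpret normal N "alt_group n" by (rule N)
  define b c d where "b = p a" and "c = p b" and "d = p c"
  have perm: "p permutes {1..n}"
    using p subset alt_group_carrier by blast
  then have "{a, b, c, d} \<subseteq> {1..n}"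
    using a permutes_in_image[OF perm] by (auto simp: b_def c_def d_def simp del: atLeastAtMost_iff)
  moreover have dist: "distinct [a, b, c, d]"
    using d by (simp add: b_def c_def d_def)
  moreover have "cycle_of_list [b, c, d] \<circ> cycle_of_list [c, b, a] \<in> N"
    using alt_group_normal_commutator[OF N p, of a b c] calculation
    by (simp add: b_def c_def d_def)
  moreover have "cycle_of_list [b, c, d] \<circ> cycle_of_list [c, b, a] = cycle_of_list [a, d, b]"
    using dist by (auto simp: transpose_def fun_eq_iff)
  ultimately show ?thesis
    using alt_group_normal_three_cycle[OF N n, of a d b] by auto
qed

text \<open>A nontrivial \<open>p\<close> in a normal subgroup either has an orbit of length at
  least 3 or is an involution. In every case at most two successive commutators with 3-cycles lead
  from \<open>p\<close> to a 3-cycle.\<close>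

theorem simple_group_alt_group:
  assumes n: "n \<ge> 5"
  shows "simple_group (alt_group n)"
proof -
  interpret A: group "alt_group n" by (rule alt_group_is_group)
  have "(fact 5 :: nat) \<le> fact n"
    using n by (rule fact_mono_nat)
  then have "order (alt_group n) > 1"
    using alt_group_card_carrier[of n] n by (simp add: order_def fact_numeral)
  moreover have "N = carrier (alt_group n) \<or> N = {\<one>\<^bsub>alt_group n\<^esub>}" if N: "N \<lhd> alt_group n" for N
  proof (rule disjCI)
    interpret normal N "alt_group n" by (rule N)
    assume "N \<noteq> {\<one>\<^bsub>alt_group n\<^esub>}"
    then obtain p where p: "p \<in> N" "p \<noteq> id"
      using one_closed by (auto simp: alt_group_one)
    then have perm: "p permutes {1..n}"
      using subset alt_group_carrier by blast
    have im: "p x \<in> {1..n} \<longleftrightarrow> x \<in> {1..n}" for x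
      using permutes_in_image[OF perm] .
    have inj: "p x = p y \<longleftrightarrow> x = y" for x y
      using permutes_inj[OF perm] by (simp add: inj_eq)
    have fix_out: "x \<in> {1..n}" if "p x \<noteq> x" for x
      using that permutes_not_in[OF perm] by blast
    show "N = carrier (alt_group n)"
    proof (cases "\<exists>a. p (p a) \<noteq> a")
      case True
      then obtain a where a: "p (p a) \<noteq> a" by blast
      define b c where "b = p a" and "c = p b"
      have dist: "distinct [a, b, c]"
        using a inj by (auto simp: b_def c_def)
      have abc: "{a, b, c} \<subseteq> {1..n}"
        using dist fix_out im unfolding b_def c_def
        by (metis distinct_length_2_or_more empty_subsetI insert_subset)
      show ?thesis
      proof (cases "p c = a")
        case False
        then have "distinct [a, p a, p (p a), p (p (p a))]"
          using dist inj by (auto simp: b_def c_def)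
        then show ?thesis
          using alt_group_normal_long_cycle[OF N n p(1)] abc by auto
      next
        case pc: True
        show ?thesis
        proof (cases "\<exists>d. d \<notin> {a, b, c} \<and> p d \<noteq> d")
          case False
          then have "p = cycle_of_list [a, b, c]"
            using dist pc by (auto simp: fun_eq_iff cycle3_apply b_def c_def simp del: cycle_of_list.simps)
          then show ?thesis
            using alt_group_normal_three_cycle[OF N n dist abc] p by simp
        next
          case True
          then obtain d where d: "d \<notin> {a, b, c}" "p d \<noteq> d" by blast
          define e where "e = p d"
          have e: "distinct [a, b, c, d, e]"
            using d dist pc inj unfolding e_def b_def c_def by auto
          have eS: "{a, b, c, d, e} \<subseteq> {1..n}"
            using abc fix_out[OF d(2)] im e_def by auto
          \<comment> \<open>This is the commutator of \<open>p\<close> with \<open>(a b d)\<close>.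
            It sends \<open>a\<close> to \<open>d\<close>, \<open>d\<close> to \<open>c\<close> and
            \<open>c\<close> to \<open>e\<close>, four distinct points.\<close>
          define r where "r = cycle_of_list [b, c, e] \<circ> cycle_of_list [d, b, a]"
          have "r \<in> N"
            using alt_group_normal_commutator[OF N p(1), of a b d] e eS
            by (simp add: r_def b_def c_def e_def)
          moreover have "r a = d" "r d = c" "r c = e"
            using e unfolding r_def by (auto simp: transpose_def)
          ultimately show ?thesis
            using alt_group_normal_long_cycle[OF N n, of r a] e eS by auto
        qed
      qed
    next
      case False
      then have invol: "p (p x) = x" for x by blast
      obtain a where a: "p a \<noteq> a"
        using p(2) by (auto simp: fun_eq_iff)
      define b where "b = p a"
      have ab: "a \<noteq> b" "a \<in> {1..n}" "b \<in> {1..n}" "p b = a" "p a = b"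
        using a fix_out[OF a] im invol by (auto simp: b_def)
      \<comment> \<open>The commutator of \<open>r\<close> with \<open>(a' b' e)\<close> is the
        square of the inverse of that 3-cycle, hence the 3-cycle itself.\<close>
      have by_fixed_point: "N = carrier (alt_group n)"
        if r: "r \<in> N" "r a' = b'" "r b' = a'" "r e = e" "distinct [a', b', e]" "{a', b', e} \<subseteq> {1..n}"
        for r a' b' e
      proof -
        have "cycle_of_list [b', a', e] \<circ> cycle_of_list [e, b', a'] \<in> N"
          using alt_group_normal_commutator[OF N r(1,5,6)] r by simp
        moreover have "cycle_of_list [b', a', e] \<circ> cycle_of_list [e, b', a'] = cycle_of_list [a', b', e]"
          using r(5) by (auto simp: transpose_def fun_eq_iff)
        ultimately show ?thesis
          using alt_group_normal_three_cycle[OF N n r(5,6)] by simp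
      qed
      have "card {a, b} \<le> 2"
        by (simp add: card_insert_if)
      then have "\<not> {1..n} \<subseteq> {a, b}"
        using n card_mono[of "{a, b}" "{1..n}"] by auto
      then obtain c where c: "c \<in> {1..n}" "c \<notin> {a, b}" by blast
      define d where "d = p c"
      show ?thesis
      proof (cases "d = c")
        case True
        then show ?thesis
          using by_fixed_point[OF p(1), of a b c] ab c by (auto simp: d_def)
      next
        case False
        have d: "distinct [a, b, c, d]" "d \<in> {1..n}"
          using False c ab inj im invol unfolding d_def by auto
        have "card {a, b, c, d} \<le> 4"
          by (simp add: card_insert_if)
        then have "\<not> {1..n} \<subseteq> {a, b, c, d}"
          using n card_mono[of "{a, b, c, d}" "{1..n}"] by auto
        then obtain e where e: "e \<in> {1..n}" "e \<notin> {a, b, c, d}" by blast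
        \<comment> \<open>Here \<open>p\<close> swaps \<open>a\<close> with \<open>b\<close> and
          \<open>c\<close> with \<open>d\<close>. Its commutator with \<open>(a b c)\<close> is
          \<open>(a c)(b d)\<close>, which fixes the fifth point \<open>e\<close> even if
          \<open>p\<close> moves it.\<close>
        define r where "r = cycle_of_list [b, a, d] \<circ> cycle_of_list [c, b, a]"
        have "r \<in> N"
          using alt_group_normal_commutator[OF N p(1), of a b c] d ab c
          by (simp add: r_def d_def)
        moreover have "r a = c" "r c = a" "r e = e"
          using d e unfolding r_def by (auto simp: transpose_def)
        ultimately show ?thesis
          using by_fixed_point[of r a c e] d e ab c by auto
      qed
    qed
  qed
  ultimately show ?thesis
    by (simp add: simple_group_def simple_group_axioms_def alt_group_is_group)
qed

section \<open>Two generators for alternating groups of odd degree\<close>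

lemma alt_group_generated_by_consecutive_cycles:
  assumes B: "subgroup B (alt_group n)"
    and mem: "\<And>i. \<lbrakk>1 \<le> i; i + 2 \<le> n\<rbrakk> \<Longrightarrow> cycle_of_list [i, i + 1, i + 2] \<in> B"
  shows "B = carrier (alt_group n)"
proof -
  have comp: "p \<circ> r \<in> B" if "p \<in> B" "r \<in> B" for p r
    using subgroup.m_closed[OF B that] by (simp add: alt_group_mult)
  have inv: "inv' p \<in> B" if "p \<in> B" for p
    using subgroup.m_inv_closed[OF B that] subgroup.mem_carrier[OF B that]
    by (simp add: alt_group_inv_equality)
  \<comment> \<open>Induction on \<open>k\<close>: some even \<open>t \<in> B\<close> on
    \<open>{1..Suc k}\<close> brings \<open>p (Suc k)\<close> back to \<open>Suc k\<close>, so that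
    \<open>t \<circ> p\<close> is an even permutation of \<open>{1..k}\<close> and lies in
    \<open>B\<close> by induction.\<close>
  have step: "p \<in> B" if "k \<le> n" "p permutes {1..k}" "evenperm p" for k p
    using that
  proof (induction k arbitrary: p)
    case 0
    then show ?case
      using subgroup.one_closed[OF B] by (simp add: alt_group_one flip: id_def)
  next
    case (Suc k)
    have restrict: "r permutes {1..k}" if "r permutes {1..Suc k}" "r (Suc k) = Suc k" for r
      using that by (intro permutes_superset[OF that(1)]) (auto simp: le_Suc_eq)
    define j where "j = p (Suc k)"
    have j: "j \<in> {1..Suc k}"
      using permutes_in_image[OF Suc.prems(2), of "Suc k"] by (simp add: j_def)
    show ?case
    proof (cases "j = Suc k")
      case True
      then show ?thesis
        using Suc restrict by (simp add: j_def)
    next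
      case False
      have "k \<noteq> 0"
        using j False by auto
      \<comment> \<open>There is no 3-cycle on \<open>{1, 2}\<close> to work with, but the only even
        permutation there is the identity.\<close>
      moreover have "k \<noteq> 1"
      proof
        assume k: "k = 1"
        have "{1..Suc 1} = {1, 2 :: nat}" by auto
        then have "p permutes {1, 2}"
          using Suc.prems(2) k by simp
        then have "p = id"
          using Suc.prems(3) by (auto simp: permutes_doubleton_iff evenperm_swap)
        then show False
          using False by (simp add: j_def)
      qed
      ultimately have k: "k \<ge> 2" by simp
      \<comment> \<open>Descending induction on \<open>j\<close>, starting at \<open>j = k\<close>:
        the cycle \<open>(k-1 k k+1)\<close> takes \<open>k\<close> to \<open>k+1\<close>, and
        \<open>(i i+1 i+2)\<close> takes \<open>i\<close> to \<open>i+1\<close>, from where the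
        \<open>t\<close> already found finishes.\<close>
      have "\<exists>t \<in> B. t permutes {1..Suc k} \<and> evenperm t \<and> t j = Suc k"
      proof -
        have "j \<le> k"
          using j False by simp
        then show ?thesis
          using j
        proof (induction j rule: inc_induct)
          case base
          have "cycle_of_list [k - 1, k, k + 1] \<in> carrier (alt_group (Suc k))"
            using k by (intro cycle_in_alt_group) auto
          moreover have "cycle_of_list [k - 1, k, k + 1] \<in> B"
            using mem[of "k - 1"] k Suc.prems(1) by (simp del: cycle_of_list.simps)
          moreover have "cycle_of_list [k - 1, k, k + 1] k = Suc k"
            using k by (subst cycle3_apply) auto
          ultimately show ?case
            by (auto simp: alt_group_carrier simp del: cycle_of_list.simps)
        next
          case (step i)
          then obtain t where t: "t \<in> B" "t permutes {1..Suc k}" "evenperm t" "t (Suc i) = Suc k"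
            by auto
          define c where "c = cycle_of_list [i, i + 1, i + 2]"
          have c: "c permutes {1..Suc k}" "evenperm c" "c i = Suc i" "c \<in> B"
            using cycle_in_alt_group[of "[i, i + 1, i + 2]" "Suc k"] mem[of i] step Suc.prems(1)
            by (auto simp: c_def alt_group_carrier cycle3_apply simp del: cycle_of_list.simps)
          have "permutation t" "permutation c"
            using t(2) c(1) permutation_permutes by blast+
          then have "evenperm (t \<circ> c)"
            using t c by (simp add: evenperm_comp)
          moreover have "(t \<circ> c) permutes {1..Suc k}"
            using permutes_compose[OF c(1) t(2)] .
          moreover have "(t \<circ> c) i = Suc k" "t \<circ> c \<in> B"
            using t c comp by auto
          ultimately show ?case by blast
        qed
      qed
      then obtain t where t: "t \<in> B" "t permutes {1..Suc k}" "evenperm t" "t j = Suc k" by blast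
      have "permutation t" "permutation p"
        using t(2) Suc.prems(2) permutation_permutes by blast+
      then have "evenperm (t \<circ> p)"
        using t Suc.prems by (simp add: evenperm_comp)
      moreover have "(t \<circ> p) permutes {1..k}"
        using restrict permutes_compose[OF Suc.prems(2) t(2)] t(4) by (simp add: j_def)
      ultimately have "t \<circ> p \<in> B"
        using Suc by simp
      then have "inv' t \<circ> (t \<circ> p) \<in> B"
        using comp inv t(1) by blast
      then show ?thesis
        using permutes_inv_o(2)[OF t(2)] by (simp add: o_assoc)
    qed
  qed
  show ?thesis
    using step[of n] subgroup.subset[OF B] by (auto simp: alt_group_carrier)
qed

lemma cycle_upt_apply:
  assumes "1 \<le> i" "i < n"
  shows "cycle_of_list [1..<Suc n] i = Suc i"
proof -
  have "map (cycle_of_list [1..<Suc n]) [1..<Suc n] = rotate1 [1..<Suc n]"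
    using cyclic_rotation[of "[1..<Suc n]" 1] by simp
  then have "map (cycle_of_list [1..<Suc n]) [1..<Suc n] ! (i - 1) = rotate1 [1..<Suc n] ! (i - 1)"
    by (rule arg_cong)
  moreover have "map (cycle_of_list [1..<Suc n]) [1..<Suc n] ! (i - 1) = cycle_of_list [1..<Suc n] i"
    using assms by (subst nth_map) (auto simp del: upt_Suc)
  moreover have "rotate1 [1..<Suc n] ! (i - 1) = Suc i"
    using assms by (subst nth_rotate1) (auto simp del: upt_Suc)
  ultimately show ?thesis by simp
qed

text \<open>Conjugation by the n-cycle shifts \<open>(i i+1 i+2)\<close> to
  \<open>(i+1 i+2 i+3)\<close>, so \<open>(1 2 3)\<close> yields all consecutive 3-cycles. The
  degree is odd so that the n-cycle is even.\<close>

lemma alt_group_two_generators: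
  assumes n: "n \<ge> 5" "odd n"
  shows "cycle_of_list [1, 2, 3] \<in> carrier (alt_group n)"
    and "cycle_of_list [1..<Suc n] \<in> carrier (alt_group n)"
    and "generate (alt_group n) {cycle_of_list [1, 2, 3], cycle_of_list [1..<Suc n]} = carrier (alt_group n)"
      (is "generate _ {?a, ?b} = _")
proof -
  show a: "?a \<in> carrier (alt_group n)"
    using n by (intro cycle_in_alt_group) auto
  show b: "?b \<in> carrier (alt_group n)"
    using n by (intro cycle_in_alt_group) auto
  interpret A: group "alt_group n" by (rule alt_group_is_group)
  have sub: "subgroup (generate (alt_group n) {?a, ?b}) (alt_group n)" (is "subgroup ?B _")
    using a b by (intro A.generate_is_subgroup) auto
  show "?B = carrier (alt_group n)"
  proof (rule alt_group_generated_by_consecutive_cycles[OF sub])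
    fix i :: nat assume "1 \<le> i" "i + 2 \<le> n"
    then show "cycle_of_list [i, i + 1, i + 2] \<in> ?B"
    proof (induction i rule: dec_induct)
      case base
      have "?a \<in> ?B"
        by (rule generate.incl) simp
      then show ?case
        by (simp only: one_add_one numeral_plus_one arith_simps flip: numeral_One)
    next
      case (step i)
      let ?c = "cycle_of_list [i, i + 1, i + 2]"
      have "?b \<in> ?B"
        by (rule generate.incl) simp
      then have "?b \<otimes>\<^bsub>alt_group n\<^esub> ?c \<otimes>\<^bsub>alt_group n\<^esub> inv\<^bsub>alt_group n\<^esub> ?b \<in> ?B"
        using step by (intro subgroup.m_closed[OF sub] subgroup.m_inv_closed[OF sub])
          (simp_all del: cycle_of_list.simps upt_Suc)
      moreover have "?b \<circ> ?c \<circ> inv' ?b = cycle_of_list [?b i, ?b (i + 1), ?b (i + 2)]"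
        using conjugation_of_cycle[of "[i, i + 1, i + 2]" ?b, OF _ permutation_bijective[OF permutation_of_cycle]]
        by (simp del: cycle_of_list.simps upt_Suc)
      moreover have "?b i = Suc i" "?b (i + 1) = Suc i + 1" "?b (i + 2) = Suc i + 2"
        using step cycle_upt_apply[of i n] cycle_upt_apply[of "i + 1" n] cycle_upt_apply[of "i + 2" n]
        by auto
      ultimately show ?case
        using b by (simp add: alt_group_mult alt_group_inv_equality del: cycle_of_list.simps upt_Suc)
    qed
  qed
qed

section \<open>Elements of prime order q in the alternating group of degree q + 2\<close>

lemma alt_group_pow: "p [^]\<^bsub>alt_group n\<^esub> (k :: nat) = p ^^ k"
  by (induction k) (simp_all add: alt_group_one alt_group_mult nat_pow_def funpow_Suc_right del: funpow.simps(2))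

text \<open>Every nontrivial orbit of \<open>p\<close>, listed by \<open>support p x\<close>, has
  \<open>q\<close> points, and two such orbits would need \<open>2 * q > q + 2\<close>
  points.\<close>

lemma prime_order_permutation_is_cycle:
  assumes q: "Factorial_Ring.prime q" "q \<ge> 3"
    and p: "p permutes {1..q + 2}" "p ^^ q = id" "p \<noteq> id"
  obtains cs where "distinct cs" "length cs = q" "set cs \<subseteq> {1..q + 2}" "p = cycle_of_list cs"
proof -
  have perm: "permutation p"
    using p(1) permutation_permutes by blast
  have orbit: "length (support p x) = q" "distinct (support p x)" "set (support p x) \<subseteq> {1..q + 2}"
    "x \<in> set (support p x)" if "p x \<noteq> x" for x
  proof -
    have "least_power p x dvd q"
      using least_power_dvd[OF perm, of x q] p(2) by simp
    then show "length (support p x) = q"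
      using least_power_gt_one[OF perm that] q(1) by (auto simp: prime_nat_iff)
    show "distinct (support p x)"
      by (rule cycle_of_permutation[OF perm])
    show "x \<in> set (support p x)"
      unfolding support_set[OF perm] using funpow_0 by (metis rangeI)
    have "x \<in> {1..q + 2}"
      using that p(1) by (metis permutes_not_in)
    then show "set (support p x) \<subseteq> {1..q + 2}"
      unfolding support_set[OF perm] using permutes_in_image[OF permutes_funpow[OF p(1)]] by blast
  qed
  obtain x where x: "p x \<noteq> x"
    using p(3) by (auto simp: fun_eq_iff)
  have "p y = cycle_of_list (support p x) y" for y
  proof (cases "y \<in> set (support p x)")
    case True
    then show ?thesis
      by (rule cycle_restrict[OF perm])
  next
    case False
    have "p y = y"
    proof (rule ccontr)
      assume y: "p y \<noteq> y"
      have "set (support p x) \<inter> set (support p y) = {}"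
        using disjoint_support'[OF perm] False by blast
      then have "card (set (support p x) \<union> set (support p y)) = 2 * q"
        using distinct_card[OF orbit(2)[OF x]] distinct_card[OF orbit(2)[OF y]]
          orbit(1)[OF x] orbit(1)[OF y] by (subst card_Un_disjoint) simp_all
      moreover have "card (set (support p x) \<union> set (support p y)) \<le> card {1..q + 2}"
        using orbit(3)[OF x] orbit(3)[OF y] by (intro card_mono) auto
      ultimately show False
        using q(2) by simp
    qed
    then show ?thesis
      using id_outside_supp[OF False] by simp
  qed
  then show thesis
    using that[of "support p x"] orbit[OF x] by blast
qed

text \<open>This is what the degree \<open>q + 2\<close> is chosen for: it is too small for two
  disjoint q-cycles, while the two points off a single q-cycle allow the conjugating permutation to
  be made even.\<close>

lemma alt_group_prime_order_conjugate:
  assumes q: "Factorial_Ring.prime q" "q \<ge> 3"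
    and x: "x \<in> carrier (alt_group (q + 2))" "x [^]\<^bsub>alt_group (q + 2)\<^esub> q = \<one>\<^bsub>alt_group (q + 2)\<^esub>"
      "x \<noteq> \<one>\<^bsub>alt_group (q + 2)\<^esub>"
    and y: "y \<in> carrier (alt_group (q + 2))" "y [^]\<^bsub>alt_group (q + 2)\<^esub> q = \<one>\<^bsub>alt_group (q + 2)\<^esub>"
      "y \<noteq> \<one>\<^bsub>alt_group (q + 2)\<^esub>"
  shows "\<exists>s \<in> carrier (alt_group (q + 2)).
    y = s \<otimes>\<^bsub>alt_group (q + 2)\<^esub> x \<otimes>\<^bsub>alt_group (q + 2)\<^esub> inv\<^bsub>alt_group (q + 2)\<^esub> s"
proof -
  obtain xs where xs: "distinct xs" "length xs = q" "set xs \<subseteq> {1..q + 2}" "x = cycle_of_list xs"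
    using prime_order_permutation_is_cycle[OF q] x
    by (metis alt_group_carrier alt_group_one alt_group_pow)
  obtain ys where ys: "distinct ys" "length ys = q" "set ys \<subseteq> {1..q + 2}" "y = cycle_of_list ys"
    using prime_order_permutation_is_cycle[OF q] y
    by (metis alt_group_carrier alt_group_one alt_group_pow)
  obtain s where "s \<in> carrier (alt_group (q + 2))" "s \<circ> x \<circ> inv' s = y"
    using alt_group_cycles_conjugate[OF xs(1,3) ys(1,3)] xs ys by auto
  then show ?thesis
    by (auto simp: alt_group_mult alt_group_inv_equality intro!: bexI[of _ s])
qed

lemma alt_group_prime_order_element:
  assumes "Factorial_Ring.prime q" "q \<ge> 3"
  shows "\<exists>x \<in> carrier (alt_group (q + 2)).
    x [^]\<^bsub>alt_group (q + 2)\<^esub> q = \<one>\<^bsub>alt_group (q + 2)\<^esub> \<and> x \<noteq> \<one>\<^bsub>alt_group (q + 2)\<^esub>"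
proof
  let ?x = "cycle_of_list [1..<Suc q]"
  have "odd q"
    using assms prime_odd_nat[of q] by auto
  then show "?x \<in> carrier (alt_group (q + 2))"
    by (intro cycle_in_alt_group) (auto simp: odd_pos Suc_le_eq)
  have "?x 1 = Suc 1"
    using assms by (intro cycle_upt_apply) auto
  then have "?x \<noteq> id"
    by (metis id_apply n_not_Suc_n)
  moreover have "?x ^^ q = id"
    using cycle_is_id_root[of "[1..<Suc q]"] by (simp del: upt_Suc)
  ultimately show "?x [^]\<^bsub>alt_group (q + 2)\<^esub> q = \<one>\<^bsub>alt_group (q + 2)\<^esub> \<and> ?x \<noteq> \<one>\<^bsub>alt_group (q + 2)\<^esub>"
    by (simp add: alt_group_pow alt_group_one)
qed

lemma alt_group_card_inj:
  assumes "m \<ge> 2" "n \<ge> 2" "card (carrier (alt_group m)) = card (carrier (alt_group n))"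
  shows "m = n"
proof -
  have "(fact m :: nat) = fact n"
    using assms alt_group_card_carrier[of m] alt_group_card_carrier[of n] by simp
  then show ?thesis
    using assms(1,2) fact_less_mono_nat[of m n] fact_less_mono_nat[of n m]
    by (cases m n rule: linorder_cases) auto
qed

section \<open>Homomorphisms out of free groups\<close>

lemma word_eval_Nil [simp]: "word_eval G [] = \<one>\<^bsub>G\<^esub>"
  by (simp add: word_eval_def)

lemma word_eval_Cons [simp]:
  "word_eval G ((e, x) # w) = (if e then x else inv\<^bsub>G\<^esub> x) \<otimes>\<^bsub>G\<^esub> word_eval G w"
  by (simp add: word_eval_def)

context group
begin

lemma word_eval_closed: "snd ` set w \<subseteq> carrier G \<Longrightarrow> word_eval G w \<in> carrier G"
  by (induction w) auto

lemma word_eval_append: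
  assumes "snd ` set u \<subseteq> carrier G" "snd ` set v \<subseteq> carrier G"
  shows "word_eval G (u @ v) = word_eval G u \<otimes> word_eval G v"
  using assms by (induction u) (auto simp: m_assoc word_eval_closed)

lemma word_eval_inverse:
  assumes "snd ` set w \<subseteq> carrier G"
  shows "word_eval G (rev (map (apfst Not) w)) = inv (word_eval G w)"
  using assms
proof (induction w)
  case (Cons a w)
  have "snd ` set (rev (map (apfst Not) w)) \<subseteq> carrier G"
    using Cons.prems by (auto simp: image_image)
  then show ?case
    using Cons by (cases a) (auto simp: word_eval_append word_eval_closed inv_mult_group)
qed simp

lemma word_eval_cancel:
  assumes "snd ` set u \<subseteq> carrier G" "snd ` set v \<subseteq> carrier G" "x \<in> carrier G"
  shows "word_eval G (u @ (e, x) # (\<not> e, x) # v) = word_eval G (u @ v)"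
proof -
  have "word_eval G ((e, x) # (\<not> e, x) # v) = word_eval G v"
    using assms word_eval_closed[OF assms(2)] by (auto simp: m_assoc[symmetric])
  moreover have "snd ` set ((e, x) # (\<not> e, x) # v) \<subseteq> carrier G"
    using assms by auto
  ultimately show ?thesis
    using assms by (simp only: word_eval_append)
qed

lemma generate_word:
  assumes "S \<subseteq> carrier G" "x \<in> generate G S"
  obtains w where "snd ` set w \<subseteq> S" "word_eval G w = x"
proof -
  from assms(2) have "\<exists>w. snd ` set w \<subseteq> S \<and> word_eval G w = x"
  proof induction
    case one
    show ?case by (rule exI[of _ "[]"]) simp
  next
    case (incl h)
    then show ?case
      using assms(1) by (intro exI[of _ "[(True, h)]"]) auto
  next
    case (inv h)
    then show ?case
      using assms(1) by (intro exI[of _ "[(False, h)]"]) auto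
  next
    case (eng h1 h2)
    then obtain u v where "snd ` set u \<subseteq> S" "word_eval G u = h1" "snd ` set v \<subseteq> S" "word_eval G v = h2"
      by blast
    then show ?case
      using assms(1) by (intro exI[of _ "u @ v"]) (auto simp: word_eval_append image_Un)
  qed
  then show thesis
    using that by blast
qed

end

lemma not_reduced_wordE:
  assumes "\<not> reduced_word S w" "snd ` set w \<subseteq> S"
  obtains u e x v where "w = u @ (e, x) # (\<not> e, x) # v"
proof -
  obtain i where i: "Suc i < length w" "snd (w ! i) = snd (w ! Suc i)" "fst (w ! i) \<noteq> fst (w ! Suc i)"
    using assms by (auto simp: reduced_word_def)
  then have "w = take i w @ w ! i # w ! Suc i # drop (Suc (Suc i)) w"
    by (metis Cons_nth_drop_Suc Suc_lessD append_take_drop_id)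
  moreover have "w ! i = (fst (w ! i), snd (w ! i))" "w ! Suc i = (\<not> fst (w ! i), snd (w ! i))"
    using i by (auto simp: prod_eq_iff)
  ultimately show thesis
    using that by metis
qed

text \<open>A word that is trivial in \<open>F\<close> is empty or contains a cancelling pair.
  Deleting the pair changes neither its value in \<open>F\<close> nor the value of the substituted
  word in \<open>T\<close>, so induction on the length applies.\<close>

lemma free_basis_word_eval_one:
  assumes F: "group F" and S: "free_basis F S" and T: "group T" and f: "f \<in> S \<rightarrow> carrier T"
    and w: "snd ` set w \<subseteq> S" "word_eval F w = \<one>\<^bsub>F\<^esub>"
  shows "word_eval T (map (apsnd f) w) = \<one>\<^bsub>T\<^esub>"
  using w
proof (induction "length w" arbitrary: w rule: less_induct)
  case less
  have SF: "S \<subseteq> carrier F"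
    using S by (simp add: free_basis_def)
  show ?case
  proof (cases "reduced_word S w")
    case True
    then have "w = []"
      using S less.prems by (auto simp: free_basis_def)
    then show ?thesis by simp
  next
    case False
    then obtain u e x v where w: "w = u @ (e, x) # (\<not> e, x) # v"
      using not_reduced_wordE less.prems by blast
    then have sub: "snd ` set u \<subseteq> S" "snd ` set v \<subseteq> S" "x \<in> S"
      using less.prems(1) by auto
    have "word_eval F (u @ v) = \<one>\<^bsub>F\<^esub>"
      using group.word_eval_cancel[OF F subset_trans[OF sub(1) SF] subset_trans[OF sub(2) SF]
        subsetD[OF SF sub(3)], of e] less.prems(2) by (simp add: w)
    then have "word_eval T (map (apsnd f) (u @ v)) = \<one>\<^bsub>T\<^esub>"
      using w sub by (intro less.hyps) auto
    moreover have "word_eval T (map (apsnd f) w) = word_eval T (map (apsnd f) (u @ v))"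
      using group.word_eval_cancel[OF T, of "map (apsnd f) u" "map (apsnd f) v" "f x" e] sub f
      by (force simp: w)
    ultimately show ?thesis by simp
  qed
qed

text \<open>The image of an element is found by spelling it as a word, substituting and evaluating
  in \<open>T\<close>. Two spellings \<open>u\<close> and \<open>v\<close> give the same result
  because \<open>u\<close> followed by the inverse word of \<open>v\<close> is trivial in
  \<open>F\<close>. This is the universal property of a free group.\<close>

lemma free_basis_extend_hom:
  assumes F: "group F" and S: "free_basis F S" and T: "group T" and f: "f \<in> S \<rightarrow> carrier T"
  obtains h where "h \<in> hom F T" "\<And>s. s \<in> S \<Longrightarrow> h s = f s"
proof -
  interpret F: group F by (rule F)
  interpret T: group T by (rule T)
  have SF: "S \<subseteq> carrier F" "generate F S = carrier F"
    using S by (auto simp: free_basis_def)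
  define ev where "ev = (\<lambda>w. word_eval T (map (apsnd f) w))"
  have fT: "snd ` set (map (apsnd f) w) \<subseteq> carrier T" if "snd ` set w \<subseteq> S" for w :: "(bool \<times> 'a) list"
    using that f by (force simp: image_image)
  have ev_app: "ev (u @ v) = ev u \<otimes>\<^bsub>T\<^esub> ev v" if "snd ` set u \<subseteq> S" "snd ` set v \<subseteq> S" for u v
    unfolding ev_def map_append using that by (intro T.word_eval_append fT)
  have ev_eq: "ev u = ev v" if u: "snd ` set u \<subseteq> S" and v: "snd ` set v \<subseteq> S"
    and eq: "word_eval F u = word_eval F v" for u v
  proof -
    define v' where "v' = rev (map (apfst Not) v)"
    have v': "snd ` set v' \<subseteq> S"
      using v by (auto simp: v'_def image_image)
    have "word_eval F (u @ v') = word_eval F u \<otimes>\<^bsub>F\<^esub> inv\<^bsub>F\<^esub> word_eval F v"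
      using u v v' SF F.word_eval_inverse[of v] F.word_eval_append[of u v'] by (auto simp: v'_def)
    also have "\<dots> = \<one>\<^bsub>F\<^esub>"
      using eq v SF F.word_eval_closed[of v] by auto
    finally have "ev (u @ v') = \<one>\<^bsub>T\<^esub>"
      unfolding ev_def using u v' by (intro free_basis_word_eval_one[OF F S T f]) auto
    moreover have "ev v' = inv\<^bsub>T\<^esub> ev v"
    proof -
      have "map (apsnd f) v' = rev (map (apfst Not) (map (apsnd f) v))"
        by (simp add: v'_def rev_map apfst_def apsnd_def map_prod_def case_prod_beta comp_def)
      then show ?thesis
        unfolding ev_def using T.word_eval_inverse[OF fT[OF v]] by simp
    qed
    ultimately have "ev u \<otimes>\<^bsub>T\<^esub> inv\<^bsub>T\<^esub> ev v = \<one>\<^bsub>T\<^esub>"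
      using ev_app[OF u v'] by simp
    then show ?thesis
      using T.word_eval_closed[OF fT[OF u]] T.word_eval_closed[OF fT[OF v]]
      unfolding ev_def by (metis T.inv_closed T.inv_equality T.inv_inv)
  qed
  define wd where "wd = (\<lambda>x. SOME w. snd ` set w \<subseteq> S \<and> word_eval F w = x)"
  have wd: "snd ` set (wd x) \<subseteq> S" "word_eval F (wd x) = x" if "x \<in> carrier F" for x
  proof -
    have "\<exists>w. snd ` set w \<subseteq> S \<and> word_eval F w = x"
      using F.generate_word[OF SF(1), of x] that SF(2) by metis
    from someI_ex[OF this] show "snd ` set (wd x) \<subseteq> S" "word_eval F (wd x) = x"
      by (auto simp: wd_def)
  qed
  show thesis
  proof
    show "(\<lambda>x. ev (wd x)) \<in> hom F T"
    proof (rule homI)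
      fix x assume "x \<in> carrier F"
      then show "ev (wd x) \<in> carrier T"
        unfolding ev_def using wd by (intro T.word_eval_closed fT)
    next
      fix x y assume xy: "x \<in> carrier F" "y \<in> carrier F"
      have "ev (wd (x \<otimes>\<^bsub>F\<^esub> y)) = ev (wd x @ wd y)"
      proof (rule ev_eq)
        show "word_eval F (wd (x \<otimes>\<^bsub>F\<^esub> y)) = word_eval F (wd x @ wd y)"
          using xy wd SF(1) by (subst F.word_eval_append) auto
        show "snd ` set (wd x @ wd y) \<subseteq> S"
          unfolding set_append image_Un using wd(1)[OF xy(1)] wd(1)[OF xy(2)] by simp
      qed (use wd(1) xy in simp)
      then show "ev (wd (x \<otimes>\<^bsub>F\<^esub> y)) = ev (wd x) \<otimes>\<^bsub>T\<^esub> ev (wd y)"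
        using ev_app[OF wd(1)[OF xy(1)] wd(1)[OF xy(2)]] by simp
    qed
  next
    fix s assume s: "s \<in> S"
    have "ev (wd s) = ev [(True, s)]"
      using s SF(1) wd[of s] by (intro ev_eq) auto
    then show "ev (wd s) = f s"
      using s f by (auto simp: ev_def Pi_iff)
  qed
qed

section \<open>Twisted conjugacy and simple quotients\<close>

text \<open>Some element of order dividing \<open>q\<close> is mapped by every automorphism to a conjugate of itself.\<close>
definition twist_separating :: "('b, 'c) monoid_scheme \<Rightarrow> bool" where
  "twist_separating T \<longleftrightarrow> (\<exists>q x0. x0 \<in> carrier T \<and> x0 \<noteq> \<one>\<^bsub>T\<^esub> \<and> x0 [^]\<^bsub>T\<^esub> (q :: nat) = \<one>\<^bsub>T\<^esub> \<and>
    (\<forall>y \<in> carrier T. y \<noteq> \<one>\<^bsub>T\<^esub> \<longrightarrow> y [^]\<^bsub>T\<^esub> q = \<one>\<^bsub>T\<^esub> \<longrightarrow>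
      (\<exists>s \<in> carrier T. y = s \<otimes>\<^bsub>T\<^esub> x0 \<otimes>\<^bsub>T\<^esub> inv\<^bsub>T\<^esub> s)))"

text \<open>
  \<open>\<beta> = \<alpha> \<circ> \<rho>\<close> for an injective endomorphism \<open>\<alpha>\<close> of \<open>T\<close>. If every element of \<open>T\<close> had the form
  \<open>t \<alpha>(t)\<^sup>-\<^sup>1\<close>, then some conjugate of \<open>x0\<close> would be fixed by \<open>\<alpha>\<close>; but then \<open>t \<mapsto> t \<alpha>(t)\<^sup>-\<^sup>1\<close> is not injective
  on the finite group \<open>T\<close>, so it is not surjective either.
\<close>
lemma twist_separatingD:
  assumes K: "group K" and T: "group T" and fin: "finite (carrier T)" and sep: "twist_separating T"
    and \<rho>: "\<rho> \<in> hom K T" "\<rho> ` carrier K = carrier T" and \<beta>: "\<beta> \<in> hom K T"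
    and ker: "\<And>g. g \<in> carrier K \<Longrightarrow> \<rho> g = \<one>\<^bsub>T\<^esub> \<longleftrightarrow> \<beta> g = \<one>\<^bsub>T\<^esub>"
  shows "\<exists>t \<in> carrier T. \<forall>g \<in> carrier K. t \<noteq> \<rho> g \<otimes>\<^bsub>T\<^esub> inv\<^bsub>T\<^esub> \<beta> g"
proof (rule ccontr)
  interpret T: group T by (rule T)
  interpret K: group K by (rule K)
  interpret \<rho>: group_hom K T \<rho>
    using \<rho> by unfold_locales
  interpret \<beta>: group_hom K T \<beta>
    using \<beta> by unfold_locales
  assume "\<not> ?thesis"
  then have onto: "\<exists>g \<in> carrier K. t = \<rho> g \<otimes>\<^bsub>T\<^esub> inv\<^bsub>T\<^esub> \<beta> g" if "t \<in> carrier T" for t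
    using that by blast
  \<comment> \<open>This makes the map \<alpha> with
    \<open>\<beta> = \<alpha> \<circ> \<rho>\<close> well defined.\<close>
  have factor: "\<beta> g = \<beta> h" if "g \<in> carrier K" "h \<in> carrier K" "\<rho> g = \<rho> h" for g h
  proof -
    have "\<rho> (g \<otimes>\<^bsub>K\<^esub> inv\<^bsub>K\<^esub> h) = \<one>\<^bsub>T\<^esub>"
      using that by simp
    then have "\<beta> (g \<otimes>\<^bsub>K\<^esub> inv\<^bsub>K\<^esub> h) = \<one>\<^bsub>T\<^esub>"
      using ker[of "g \<otimes>\<^bsub>K\<^esub> inv\<^bsub>K\<^esub> h"] that by simp
    then have "\<beta> g \<otimes>\<^bsub>T\<^esub> inv\<^bsub>T\<^esub> \<beta> h = \<one>\<^bsub>T\<^esub>"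
      using that by simp
    then show ?thesis
      using that by (metis T.inv_closed T.inv_equality T.inv_inv \<beta>.hom_closed)
  qed
  obtain q :: nat and x0 where x0: "x0 \<in> carrier T" "x0 \<noteq> \<one>\<^bsub>T\<^esub>" "x0 [^]\<^bsub>T\<^esub> q = \<one>\<^bsub>T\<^esub>"
    and conj: "\<And>y. \<lbrakk>y \<in> carrier T; y \<noteq> \<one>\<^bsub>T\<^esub>; y [^]\<^bsub>T\<^esub> q = \<one>\<^bsub>T\<^esub>\<rbrakk> \<Longrightarrow>
      \<exists>s \<in> carrier T. y = s \<otimes>\<^bsub>T\<^esub> x0 \<otimes>\<^bsub>T\<^esub> inv\<^bsub>T\<^esub> s"
    using sep unfolding twist_separating_def by blast
  obtain k where k: "k \<in> carrier K" "\<rho> k = x0"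
    using x0(1) \<rho>(2) by (metis imageE)
  have "\<rho> (k [^]\<^bsub>K\<^esub> q) = \<one>\<^bsub>T\<^esub>"
    using k x0 by (simp add: \<rho>.hom_nat_pow)
  then have "\<beta> k [^]\<^bsub>T\<^esub> q = \<one>\<^bsub>T\<^esub>"
    using ker[of "k [^]\<^bsub>K\<^esub> q"] k by (simp add: \<beta>.hom_nat_pow)
  moreover have "\<beta> k \<noteq> \<one>\<^bsub>T\<^esub>"
    using ker k x0 by auto
  ultimately obtain s where s: "s \<in> carrier T" "\<beta> k = s \<otimes>\<^bsub>T\<^esub> x0 \<otimes>\<^bsub>T\<^esub> inv\<^bsub>T\<^esub> s"
    using conj[of "\<beta> k"] k by auto
  \<comment> \<open>The assumption at \<open>inv s\<close> gives \<open>g = inv h\<close> with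
    \<open>\<beta> g \<otimes> s = \<rho> g\<close>. Conjugating \<open>k\<close> by
    \<open>g\<close> then turns \<open>\<beta> k\<close>, the conjugate of \<open>x0\<close> by
    \<open>s\<close>, into the same conjugate of \<open>x0\<close> that \<rho> produces.\<close>
  obtain h where h: "h \<in> carrier K" "inv\<^bsub>T\<^esub> s = \<rho> h \<otimes>\<^bsub>T\<^esub> inv\<^bsub>T\<^esub> \<beta> h"
    using onto[of "inv\<^bsub>T\<^esub> s"] s by auto
  define g where "g = inv\<^bsub>K\<^esub> h"
  have g: "g \<in> carrier K"
    using h by (simp add: g_def)
  have s_eq: "\<beta> g \<otimes>\<^bsub>T\<^esub> s = \<rho> g"
  proof -
    have "s = \<beta> h \<otimes>\<^bsub>T\<^esub> inv\<^bsub>T\<^esub> \<rho> h"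
      using h s by (metis T.inv_closed T.inv_inv T.inv_mult_group \<beta>.hom_closed \<rho>.hom_closed)
    then show ?thesis
      using h by (simp add: g_def T.m_assoc[symmetric])
  qed
  define z where "z = g \<otimes>\<^bsub>K\<^esub> k \<otimes>\<^bsub>K\<^esub> inv\<^bsub>K\<^esub> g"
  have z: "z \<in> carrier K"
    using g k by (simp add: z_def)
  have "\<beta> z = \<beta> g \<otimes>\<^bsub>T\<^esub> (s \<otimes>\<^bsub>T\<^esub> x0 \<otimes>\<^bsub>T\<^esub> inv\<^bsub>T\<^esub> s) \<otimes>\<^bsub>T\<^esub> inv\<^bsub>T\<^esub> \<beta> g"
    using g k s by (simp add: z_def)
  also have "\<dots> = (\<beta> g \<otimes>\<^bsub>T\<^esub> s) \<otimes>\<^bsub>T\<^esub> x0 \<otimes>\<^bsub>T\<^esub> inv\<^bsub>T\<^esub> (\<beta> g \<otimes>\<^bsub>T\<^esub> s)"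
    using g s x0 by (simp add: T.inv_mult_group T.m_assoc)
  also have "\<dots> = \<rho> z"
    using g k by (simp add: s_eq z_def)
  finally have fixed: "\<beta> z = \<rho> z" .
  have z1: "\<rho> z \<noteq> \<one>\<^bsub>T\<^esub>"
  proof
    assume "\<rho> z = \<one>\<^bsub>T\<^esub>"
    then have "\<rho> g \<otimes>\<^bsub>T\<^esub> x0 \<otimes>\<^bsub>T\<^esub> inv\<^bsub>T\<^esub> \<rho> g = \<one>\<^bsub>T\<^esub>"
      using g k by (simp add: z_def)
    then have "\<rho> g \<otimes>\<^bsub>T\<^esub> x0 = \<rho> g"
      using g x0 by (metis T.inv_closed T.inv_equality T.inv_inv T.m_closed \<rho>.hom_closed)
    then show False
      using g x0(1,2) T.l_cancel[of "\<rho> g" x0 "\<one>\<^bsub>T\<^esub>"] by simp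
  qed
  define r where "r = (\<lambda>t. SOME g. g \<in> carrier K \<and> \<rho> g = t)"
  have r: "r t \<in> carrier K" "\<rho> (r t) = t" if "t \<in> carrier T" for t
  proof -
    have "\<exists>g. g \<in> carrier K \<and> \<rho> g = t"
      using that unfolding \<rho>(2)[symmetric] by auto
    from someI_ex[OF this] show "r t \<in> carrier K" "\<rho> (r t) = t"
      by (auto simp: r_def)
  qed
  \<comment> \<open>This is the map t \<mapsto> t \<alpha>(t)^-1; by \<open>factor\<close> the
    chosen preimage \<open>r t\<close> does not affect its value.\<close>
  define F where "F = (\<lambda>t. t \<otimes>\<^bsub>T\<^esub> inv\<^bsub>T\<^esub> \<beta> (r t))"
  have F: "F (\<rho> g) = \<rho> g \<otimes>\<^bsub>T\<^esub> inv\<^bsub>T\<^esub> \<beta> g" if "g \<in> carrier K" for g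
    using factor[of "r (\<rho> g)" g] r[of "\<rho> g"] that by (simp add: F_def)
  have "carrier T \<subseteq> F ` carrier T"
  proof
    fix t assume "t \<in> carrier T"
    then obtain g where "g \<in> carrier K" "t = F (\<rho> g)"
      using onto F by metis
    then show "t \<in> F ` carrier T" by auto
  qed
  moreover have "F ` carrier T \<subseteq> carrier T"
    using r by (auto simp: F_def)
  ultimately have "inj_on F (carrier T)"
    using fin by (simp add: eq_card_imp_inj_on subset_antisym)
  moreover have "F (\<rho> z) = F (\<rho> \<one>\<^bsub>K\<^esub>)"
    using F[OF z] F[OF K.one_closed] z fixed by simp
  ultimately have "\<rho> z = \<rho> \<one>\<^bsub>K\<^esub>"
    using z by (auto dest: inj_onD)
  then show False
    using z1 by simp
qed

text \<open>Otherwise simplicity of \<open>S\<close> makes the image trivial, so the kernel of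
  \<tau> lies in that of \<sigma>. Then \<tau> maps the kernel of \<sigma> to a normal subgroup of
  \<open>T\<close>. If that is trivial, the kernels coincide; if it is all of \<open>T\<close>, each
  element of \<open>K\<close> differs from one in the kernel of \<sigma> by an element of the kernel
  of \<tau>, and \<sigma> would be trivial.\<close>

lemma simple_quotient_image_kernel:
  assumes K: "group K" and S: "simple_group S" and T: "simple_group T"
    and \<sigma>: "\<sigma> \<in> hom K S" "\<sigma> ` carrier K = carrier S" and \<tau>: "\<tau> \<in> hom K T" "\<tau> ` carrier K = carrier T"
    and ne: "kernel K S \<sigma> \<noteq> kernel K T \<tau>"
  shows "\<sigma> ` kernel K T \<tau> = carrier S"
proof (rule ccontr)
  interpret S: simple_group S by (rule S)
  interpret T: simple_group T by (rule T)
  interpret K: group K by (rule K)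
  interpret \<sigma>: group_hom K S \<sigma>
    using \<sigma> by unfold_locales
  interpret \<tau>: group_hom K T \<tau>
    using \<tau> by unfold_locales
  assume "\<sigma> ` kernel K T \<tau> \<noteq> carrier S"
  moreover have "\<sigma> ` kernel K T \<tau> \<lhd> S"
    using normal.surj_hom_normal_subgroup[OF \<tau>.normal_kernel \<sigma>.group_hom_axioms \<sigma>(2)] .
  ultimately have "\<sigma> ` kernel K T \<tau> = {\<one>\<^bsub>S\<^esub>}"
    using S.no_real_normal_subgroup by blast
  then have sub: "kernel K T \<tau> \<subseteq> kernel K S \<sigma>"
    by (auto simp: kernel_def)
  have "\<tau> ` kernel K S \<sigma> \<lhd> T"
    using normal.surj_hom_normal_subgroup[OF \<sigma>.normal_kernel \<tau>.group_hom_axioms \<tau>(2)] .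
  then consider "\<tau> ` kernel K S \<sigma> = carrier T" | "\<tau> ` kernel K S \<sigma> = {\<one>\<^bsub>T\<^esub>}"
    using T.no_real_normal_subgroup by blast
  then show False
  proof cases
    case 1
    have "\<sigma> x = \<one>\<^bsub>S\<^esub>" if x: "x \<in> carrier K" for x
    proof -
      have "\<tau> x \<in> \<tau> ` kernel K S \<sigma>"
        using 1 x by simp
      then obtain y where y: "y \<in> carrier K" "\<sigma> y = \<one>\<^bsub>S\<^esub>" "\<tau> y = \<tau> x"
        by (auto simp: kernel_def)
      then have "\<tau> (x \<otimes>\<^bsub>K\<^esub> inv\<^bsub>K\<^esub> y) = \<one>\<^bsub>T\<^esub>"
        using x by simp
      then have "x \<otimes>\<^bsub>K\<^esub> inv\<^bsub>K\<^esub> y \<in> kernel K T \<tau>"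
        using x y by (simp add: kernel_def)
      then have "\<sigma> (x \<otimes>\<^bsub>K\<^esub> inv\<^bsub>K\<^esub> y) = \<one>\<^bsub>S\<^esub>"
        using sub kernel_def by fast
      then show ?thesis
        using x y by simp
    qed
    then have "carrier S = {\<one>\<^bsub>S\<^esub>}"
      using \<sigma>(2) by auto
    then show False
      using S.simple_not_triv by simp
  next
    case 2
    then show False
      using sub ne by (auto simp: kernel_def)
  qed
qed

text \<open>The kernels are imposed one at a time. If \<open>x\<close> lies over \<open>a\<close> in
  the common kernel so far and \<open>y\<close> lies over \<open>b\<close> in the next kernel, then
  the commutator of \<open>x\<close> and \<open>y\<close> is in all these kernels and lies over the
  commutator of \<open>a\<close> and \<open>b\<close>. Perfectness of \<open>T i\<close> does the
  rest.\<close>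

lemma simple_quotients_joint_surjective:
  assumes K: "group K" and fin: "finite J" and i: "i \<notin> J"
    and T: "\<And>j. j \<in> insert i J \<Longrightarrow> simple_group (T j)"
    and perfect: "derived (T i) (carrier (T i)) = carrier (T i)"
    and \<rho>: "\<And>j. j \<in> insert i J \<Longrightarrow> \<rho> j \<in> hom K (T j)"
      "\<And>j. j \<in> insert i J \<Longrightarrow> \<rho> j ` carrier K = carrier (T j)"
    and ker: "\<And>j. j \<in> J \<Longrightarrow> kernel K (T i) (\<rho> i) \<noteq> kernel K (T j) (\<rho> j)"
    and t: "t \<in> carrier (T i)"
  shows "\<exists>x \<in> carrier K. \<rho> i x = t \<and> (\<forall>j \<in> J. \<rho> j x = \<one>\<^bsub>T j\<^esub>)"
proof -
  interpret K: group K by (rule K)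
  have hom: "group_hom K (T j) (\<rho> j)" if "j \<in> insert i J" for j
    using \<rho>(1)[OF that] T[OF that] K
    by (simp add: group_hom_def group_hom_axioms_def simple_group_def)
  define M where "M = (\<lambda>L. {x \<in> carrier K. \<forall>j \<in> L. \<rho> j x = \<one>\<^bsub>T j\<^esub>})"
  have sub: "subgroup (M L) K" if "L \<subseteq> J" for L
  proof
    fix x y assume xy: "x \<in> M L" "y \<in> M L"
    show "x \<otimes>\<^bsub>K\<^esub> y \<in> M L"
      using xy that by (auto simp: M_def group_hom.hom_mult[OF hom] group.is_monoid[OF group_hom.axioms(2)[OF hom]])
  next
    fix x assume x: "x \<in> M L"
    have "\<rho> j (inv\<^bsub>K\<^esub> x) = \<one>\<^bsub>T j\<^esub>" if j: "j \<in> L" for j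
    proof -
      interpret j: group_hom K "T j" "\<rho> j" by (rule hom) (use j \<open>L \<subseteq> J\<close> in auto)
      show ?thesis
        using x j by (simp add: M_def)
    qed
    then show "inv\<^bsub>K\<^esub> x \<in> M L"
      using x by (simp add: M_def)
  qed (use that in \<open>auto simp: M_def group_hom.hom_one[OF hom]\<close>)
  interpret i: group_hom K "T i" "\<rho> i" by (rule hom) simp
  have "L \<subseteq> J \<Longrightarrow> \<rho> i ` M L = carrier (T i)" if "finite L" for L
    using that
  proof (induction L)
    case empty
    show ?case
      using \<rho>(2)[of i] by (simp add: M_def)
  next
    case (insert j L)
    interpret j: group_hom K "T j" "\<rho> j" by (rule hom) (use insert in simp)
    have "subgroup (\<rho> i ` M (insert j L)) (T i)"
      using i.subgroup_img_is_subgroup[OF sub[OF insert.prems]] .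
    moreover have "derived_set (T i) (carrier (T i)) \<subseteq> \<rho> i ` M (insert j L)"
    proof safe
      fix a b assume ab: "a \<in> carrier (T i)" "b \<in> carrier (T i)"
      have "a \<in> \<rho> i ` M L"
        using ab insert by auto
      then obtain x where x: "x \<in> M L" "\<rho> i x = a" by blast
      have "b \<in> \<rho> i ` kernel K (T j) (\<rho> j)"
        using ab insert.prems simple_quotient_image_kernel[OF K T T \<rho>(1,2) \<rho>(1,2) ker, of j] by auto
      then obtain y where y: "y \<in> kernel K (T j) (\<rho> j)" "\<rho> i y = b" by blast
      define z where "z = x \<otimes>\<^bsub>K\<^esub> y \<otimes>\<^bsub>K\<^esub> inv\<^bsub>K\<^esub> x \<otimes>\<^bsub>K\<^esub> inv\<^bsub>K\<^esub> y"
      have xy: "x \<in> carrier K" "y \<in> carrier K"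
        using x y by (auto simp: M_def kernel_def)
      have "\<rho> j z = \<one>\<^bsub>T j\<^esub>"
        using xy y(1) by (simp add: z_def kernel_def)
      moreover have "\<rho> l z = \<one>\<^bsub>T l\<^esub>" if l: "l \<in> L" for l
      proof -
        interpret l: group_hom K "T l" "\<rho> l" by (rule hom) (use l insert in auto)
        have "\<rho> l x = \<one>\<^bsub>T l\<^esub>"
          using x l by (simp add: M_def)
        then show ?thesis
          using xy by (simp add: z_def)
      qed
      ultimately have "z \<in> M (insert j L)"
        using xy by (simp add: M_def z_def)
      moreover have "\<rho> i z = a \<otimes>\<^bsub>T i\<^esub> b \<otimes>\<^bsub>T i\<^esub> inv\<^bsub>T i\<^esub> a \<otimes>\<^bsub>T i\<^esub> inv\<^bsub>T i\<^esub> b"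
        using xy x y by (simp add: z_def)
      ultimately show "a \<otimes>\<^bsub>T i\<^esub> b \<otimes>\<^bsub>T i\<^esub> inv\<^bsub>T i\<^esub> a \<otimes>\<^bsub>T i\<^esub> inv\<^bsub>T i\<^esub> b \<in> \<rho> i ` M (insert j L)"
        by (metis imageI)
    qed
    ultimately have "derived (T i) (carrier (T i)) \<subseteq> \<rho> i ` M (insert j L)"
      unfolding derived_def by (intro i.H.generate_subgroup_incl) auto
    then show ?case
      using perfect by (auto simp: M_def)
  qed
  from this[OF fin subset_refl] have "t \<in> \<rho> i ` M J"
    using t by simp
  then show ?thesis
    by (auto simp: M_def)
qed

section \<open>Products along \<psi>-orbits\<close>

lemma funpow_iso: "\<psi> \<in> iso G G \<Longrightarrow> \<psi> ^^ k \<in> iso G G"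
  by (induction k) (auto intro: iso_set_trans simp: id_iso simp flip: id_def)

primrec twisted_prod :: "('b, 'c) monoid_scheme \<Rightarrow> ('a \<Rightarrow> 'b) \<Rightarrow> ('a \<Rightarrow> 'a) \<Rightarrow> nat \<Rightarrow> 'a \<Rightarrow> 'b" where
  "twisted_prod T \<rho> \<psi> 0 x = \<one>\<^bsub>T\<^esub>"
| "twisted_prod T \<rho> \<psi> (Suc n) x = \<rho> x \<otimes>\<^bsub>T\<^esub> twisted_prod T \<rho> \<psi> n (\<psi> x)"

context group_hom
begin

lemma twisted_prod_closed:
  assumes "\<psi> \<in> hom G G" "x \<in> carrier G"
  shows "twisted_prod H h \<psi> n x \<in> carrier H"
  using assms(2) by (induction n arbitrary: x) (auto simp: hom_in_carrier[OF assms(1)])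

text \<open>The factor with index k is
  \<open>h (\<psi>^k g) h (\<psi>^k y) h (\<psi>^(k+1) g)^-1\<close>; the product telescopes and
  keeps only the outermost terms in \<open>g\<close>.\<close>

lemma twisted_prod_conjugate:
  assumes \<psi>: "\<psi> \<in> hom G G" and g: "g \<in> carrier G" and y: "y \<in> carrier G"
  shows "twisted_prod H h \<psi> n (g \<otimes> y \<otimes> inv (\<psi> g)) =
    h g \<otimes>\<^bsub>H\<^esub> twisted_prod H h \<psi> n y \<otimes>\<^bsub>H\<^esub> inv\<^bsub>H\<^esub> h ((\<psi> ^^ n) g)"
  using g y
proof (induction n arbitrary: g y)
  case 0
  then show ?case by simp
next
  case (Suc n)
  interpret \<psi>: group_hom G G \<psi>
    using \<psi> by unfold_locales
  have pow: "(\<psi> ^^ n) x \<in> carrier G" if "x \<in> carrier G" for x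
    using that by (induction n) auto
  have "\<psi> (g \<otimes> y \<otimes> inv (\<psi> g)) = \<psi> g \<otimes> \<psi> y \<otimes> inv (\<psi> (\<psi> g))"
    using Suc.prems by simp
  moreover have "twisted_prod H h \<psi> n (\<psi> g \<otimes> \<psi> y \<otimes> inv (\<psi> (\<psi> g))) =
      h (\<psi> g) \<otimes>\<^bsub>H\<^esub> twisted_prod H h \<psi> n (\<psi> y) \<otimes>\<^bsub>H\<^esub> inv\<^bsub>H\<^esub> h ((\<psi> ^^ n) (\<psi> g))"
    using Suc by simp
  moreover have "h g \<otimes>\<^bsub>H\<^esub> h y \<otimes>\<^bsub>H\<^esub> inv\<^bsub>H\<^esub> h (\<psi> g) \<otimes>\<^bsub>H\<^esub>
      (h (\<psi> g) \<otimes>\<^bsub>H\<^esub> t \<otimes>\<^bsub>H\<^esub> u) = h g \<otimes>\<^bsub>H\<^esub> (h y \<otimes>\<^bsub>H\<^esub> t) \<otimes>\<^bsub>H\<^esub> u"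
    if "t \<in> carrier H" "u \<in> carrier H" for t u
  proof -
    have "inv\<^bsub>H\<^esub> h (\<psi> g) \<otimes>\<^bsub>H\<^esub> (h (\<psi> g) \<otimes>\<^bsub>H\<^esub> t \<otimes>\<^bsub>H\<^esub> u) = t \<otimes>\<^bsub>H\<^esub> u"
      using that Suc.prems by (simp add: H.m_assoc[symmetric])
    then show ?thesis
      using that Suc.prems by (simp add: H.m_assoc)
  qed
  ultimately show ?case
    using Suc.prems twisted_prod_closed[OF \<psi>] pow by (simp add: funpow_swap1)
qed

lemma twisted_prod_eq_one:
  assumes "\<And>k. k < n \<Longrightarrow> h ((\<psi> ^^ k) x) = \<one>\<^bsub>H\<^esub>"
  shows "twisted_prod H h \<psi> n x = \<one>\<^bsub>H\<^esub>"
  using assms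
proof (induction n arbitrary: x)
  case (Suc n)
  have "h ((\<psi> ^^ k) (\<psi> x)) = \<one>\<^bsub>H\<^esub>" if "k < n" for k
    using Suc.prems[of "Suc k"] that by (simp add: funpow_swap1)
  then show ?case
    using Suc.IH[of "\<psi> x"] Suc.prems[of 0] by simp
qed simp

lemma twisted_prod_single:
  assumes "n > 0" "x \<in> carrier G" "\<And>k. \<lbrakk>0 < k; k < n\<rbrakk> \<Longrightarrow> h ((\<psi> ^^ k) x) = \<one>\<^bsub>H\<^esub>"
  shows "twisted_prod H h \<psi> n x = h x"
proof -
  obtain m where m: "n = Suc m"
    using assms(1) by (cases n) auto
  have "h ((\<psi> ^^ k) (\<psi> x)) = \<one>\<^bsub>H\<^esub>" if "k < m" for k
    using assms(3)[of "Suc k"] that m by (simp add: funpow_swap1)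
  then show ?thesis
    using twisted_prod_eq_one[of m \<psi> "\<psi> x"] assms(2) m by simp
qed

end

text \<open>Choose \<open>x q\<close> so that \<rho> \<open>q\<close> takes it to an element outside
  the twisted class of the identity, while every other quotient of the orbit family kills it. The
  twisted product for \<open>q\<close> then has that value on \<open>x q\<close> and is trivial on
  \<open>x r\<close>, so \<open>x q\<close> and \<open>x r\<close> cannot be
  \<psi>-conjugate.\<close>

lemma twisted_inequivalent_family:
  fixes T :: "'i \<Rightarrow> ('t, 'c) monoid_scheme" and Q :: "'i set"
  assumes K: "group K" and \<psi>: "\<psi> \<in> iso K K" and Q: "finite Q"
    and T: "\<And>q. q \<in> Q \<Longrightarrow> simple_group (T q)" "\<And>q. q \<in> Q \<Longrightarrow> finite (carrier (T q))"
      "\<And>q. q \<in> Q \<Longrightarrow> derived (T q) (carrier (T q)) = carrier (T q)"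
      "\<And>q. q \<in> Q \<Longrightarrow> twist_separating (T q)"
      "inj_on (\<lambda>q. card (carrier (T q))) Q"
    and \<rho>: "\<And>q. q \<in> Q \<Longrightarrow> \<rho> q \<in> hom K (T q)" "\<And>q. q \<in> Q \<Longrightarrow> \<rho> q ` carrier K = carrier (T q)"
    and periodic: "\<And>q. q \<in> Q \<Longrightarrow> \<exists>c > 0. \<forall>x \<in> carrier K. \<rho> q ((\<psi> ^^ c) x) = \<one>\<^bsub>T q\<^esub> \<longleftrightarrow> \<rho> q x = \<one>\<^bsub>T q\<^esub>"
  shows "\<exists>x \<in> Q \<rightarrow> carrier K. \<forall>q \<in> Q. \<forall>r \<in> Q - {q}. \<forall>g \<in> carrier K.
    x q \<noteq> g \<otimes>\<^bsub>K\<^esub> x r \<otimes>\<^bsub>K\<^esub> inv\<^bsub>K\<^esub> (\<psi> g)"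
proof -
  interpret K: group K by (rule K)
  \<comment> \<open>The predicate says that \<psi>^c preserves the kernel of \<rho>
    \<open>q\<close>. Taking the least such \<open>c\<close> below ensures that the kernel of
    \<open>\<rho> q \<circ> \<psi> ^^ k\<close> differs from that of \<rho> \<open>q\<close> for 0 <
    k < \<open>c q\<close>.\<close>
  define per where "per = (\<lambda>q c. c > 0 \<and> (\<forall>x \<in> carrier K. \<rho> q ((\<psi> ^^ c) x) = \<one>\<^bsub>T q\<^esub> \<longleftrightarrow> \<rho> q x = \<one>\<^bsub>T q\<^esub>))"
  define c where "c = (\<lambda>q. LEAST c. per q c)"
  have c: "per q (c q)" if "q \<in> Q" for q
    unfolding c_def by (rule LeastI_ex) (use periodic[OF that] in \<open>auto simp: per_def\<close>)
  have c_least: "\<not> per q k" if "k < c q" for q k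
    using not_less_Least that unfolding c_def by blast
  have \<psi>k: "\<psi> ^^ k \<in> iso K K" for k
    by (rule funpow_iso[OF \<psi>])
  have \<psi>c: "(\<psi> ^^ k) x \<in> carrier K" if "x \<in> carrier K" for k x
    using \<psi>k[of k] that by (auto simp: iso_def hom_def)
  have Tg: "group (T q)" if "q \<in> Q" for q
    using T(1)[OF that] by (simp add: simple_group_def)
  have \<rho>k: "\<rho> q \<circ> \<psi> ^^ k \<in> hom K (T q)" "(\<rho> q \<circ> \<psi> ^^ k) ` carrier K = carrier (T q)" if "q \<in> Q" for q k
  proof -
    show "\<rho> q \<circ> \<psi> ^^ k \<in> hom K (T q)"
      using hom_compose[of "\<psi> ^^ k" K K "\<rho> q" "T q"] \<psi>k[of k] \<rho>(1)[OF that] by (simp add: iso_def)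
    have "(\<psi> ^^ k) ` carrier K = carrier K"
      using \<psi>k[of k] by (simp add: iso_iff)
    then show "(\<rho> q \<circ> \<psi> ^^ k) ` carrier K = carrier (T q)"
      using \<rho>(2)[OF that] by (simp only: image_comp[symmetric])
  qed
  \<comment> \<open>The kernel determines the order of the quotient, so quotients belonging to
    different \<open>q\<close> have different kernels.\<close>
  have card_eq: "card (carrier (K Mod kernel K (T q) f)) = card (carrier (T q))"
    if "q \<in> Q" "f \<in> hom K (T q)" "f ` carrier K = carrier (T q)" for q f
  proof -
    have "group_hom K (T q) f"
      using K Tg that by (simp add: group_hom_def group_hom_axioms_def)
    then show ?thesis
      using group_hom.FactGroup_iso_set[of K "T q" f] that(3) iso_same_card is_isoI by blast
  qed
  have sep: "\<exists>t \<in> carrier (T q). \<forall>g \<in> carrier K. t \<noteq> \<rho> q g \<otimes>\<^bsub>T q\<^esub> inv\<^bsub>T q\<^esub> \<rho> q ((\<psi> ^^ c q) g)"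
    if q: "q \<in> Q" for q
    using twist_separatingD[OF K Tg T(2,4) \<rho> \<rho>k(1)[of q "c q"]] q c[OF q] by (auto simp: per_def)
  have "\<exists>x \<in> carrier K. (\<forall>g \<in> carrier K. \<rho> q x \<noteq> \<rho> q g \<otimes>\<^bsub>T q\<^esub> inv\<^bsub>T q\<^esub> \<rho> q ((\<psi> ^^ c q) g)) \<and>
      (\<forall>r \<in> Q. \<forall>k < c r. (r, k) \<noteq> (q, 0) \<longrightarrow> \<rho> r ((\<psi> ^^ k) x) = \<one>\<^bsub>T r\<^esub>)" if q: "q \<in> Q" for q
  proof -
    obtain t where t: "t \<in> carrier (T q)"
      "\<forall>g \<in> carrier K. t \<noteq> \<rho> q g \<otimes>\<^bsub>T q\<^esub> inv\<^bsub>T q\<^esub> \<rho> q ((\<psi> ^^ c q) g)"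
      using sep[OF q] by blast
    \<comment> \<open>The pair \<open>(r, k)\<close> stands for the quotient
      \<open>\<rho> r \<circ> \<psi> ^^ k\<close>. The value at \<open>(q, 0)\<close> is prescribed
      as \<open>t\<close>; at all other pairs it is to be trivial.\<close>
    define I where "I = Sigma Q (\<lambda>r. {..<c r})"
    have I: "finite I" "insert (q, 0) (I - {(q, 0)}) = I"
      using Q q c[OF q] by (auto simp: I_def per_def)
    have "\<exists>x \<in> carrier K. (\<rho> (fst (q, 0 :: nat)) \<circ> \<psi> ^^ snd (q, 0 :: nat)) x = t \<and>
      (\<forall>j \<in> I - {(q, 0)}. (\<rho> (fst j) \<circ> \<psi> ^^ snd j) x = \<one>\<^bsub>T (fst j)\<^esub>)"
    proof (rule simple_quotients_joint_surjective[OF K, where T = "\<lambda>j. T (fst j)" and i = "(q, 0)"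
          and \<rho> = "\<lambda>j. \<rho> (fst j) \<circ> \<psi> ^^ snd j" and J = "I - {(q, 0)}"])
      fix j assume j: "j \<in> I - {(q, 0)}"
      then obtain r k where rk: "j = (r, k)" "r \<in> Q" "k < c r" "(r, k) \<noteq> (q, 0)"
        unfolding I_def by blast
      have "kernel K (T q) (\<rho> q) \<noteq> kernel K (T r) (\<rho> r \<circ> \<psi> ^^ k)"
      proof
        assume eq: "kernel K (T q) (\<rho> q) = kernel K (T r) (\<rho> r \<circ> \<psi> ^^ k)"
        have "card (carrier (T q)) = card (carrier (T r))"
          using card_eq[OF q \<rho>[OF q]] card_eq[OF rk(2) \<rho>k[OF rk(2)], of k] eq by simp
        then have "r = q"
          using T(5) q rk(2) by (auto dest: inj_onD)
        moreover have "\<rho> q ((\<psi> ^^ k) x) = \<one>\<^bsub>T q\<^esub> \<longleftrightarrow> \<rho> q x = \<one>\<^bsub>T q\<^esub>" if "x \<in> carrier K" for x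
          using eq that \<open>r = q\<close> by (auto simp: kernel_def)
        ultimately have "per q k"
          using rk by (auto simp: per_def)
        then show False
          using c_least rk \<open>r = q\<close> by blast
      qed
      then show "kernel K (T (fst (q, 0 :: nat))) (\<rho> (fst (q, 0 :: nat)) \<circ> \<psi> ^^ snd (q, 0 :: nat)) \<noteq>
          kernel K (T (fst j)) (\<rho> (fst j) \<circ> \<psi> ^^ snd j)"
        by (simp add: rk(1))
    next
      fix j assume "j \<in> insert (q, 0) (I - {(q, 0)})"
      then have "fst j \<in> Q"
        using q by (auto simp: I_def)
      then show "simple_group (T (fst j))" "\<rho> (fst j) \<circ> \<psi> ^^ snd j \<in> hom K (T (fst j))"
        "(\<rho> (fst j) \<circ> \<psi> ^^ snd j) ` carrier K = carrier (T (fst j))"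
        by (fact T(1) \<rho>k)+
    qed (use I q t T(3) in auto)
    then obtain x where x: "x \<in> carrier K" "\<rho> q x = t"
      "\<And>r k. \<lbrakk>(r, k) \<in> I; (r, k) \<noteq> (q, 0)\<rbrakk> \<Longrightarrow> \<rho> r ((\<psi> ^^ k) x) = \<one>\<^bsub>T r\<^esub>"
      by force
    then show ?thesis
      using t by (intro bexI[of _ x]) (auto simp: I_def)
  qed
  then obtain x where x: "\<And>q. q \<in> Q \<Longrightarrow> x q \<in> carrier K"
    "\<And>q g. \<lbrakk>q \<in> Q; g \<in> carrier K\<rbrakk> \<Longrightarrow> \<rho> q (x q) \<noteq> \<rho> q g \<otimes>\<^bsub>T q\<^esub> inv\<^bsub>T q\<^esub> \<rho> q ((\<psi> ^^ c q) g)"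
    "\<And>q r k. \<lbrakk>q \<in> Q; r \<in> Q; k < c r; (r, k) \<noteq> (q, 0)\<rbrakk> \<Longrightarrow> \<rho> r ((\<psi> ^^ k) (x q)) = \<one>\<^bsub>T r\<^esub>"
    by metis
  show ?thesis
  proof (intro bexI[of _ x] ballI)
    show "x \<in> Q \<rightarrow> carrier K"
      using x(1) by blast
    fix q r g assume q: "q \<in> Q" and "r \<in> Q - {q}" and g: "g \<in> carrier K"
    then have r: "r \<in> Q" "q \<noteq> r"
      by auto
    interpret q: group_hom K "T q" "\<rho> q"
      using K Tg \<rho> q by (simp add: group_hom_def group_hom_axioms_def)
    show "x q \<noteq> g \<otimes>\<^bsub>K\<^esub> x r \<otimes>\<^bsub>K\<^esub> inv\<^bsub>K\<^esub> (\<psi> g)"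
    proof
      assume eq: "x q = g \<otimes>\<^bsub>K\<^esub> x r \<otimes>\<^bsub>K\<^esub> inv\<^bsub>K\<^esub> (\<psi> g)"
      have "\<rho> q (x q) = twisted_prod (T q) (\<rho> q) \<psi> (c q) (x q)"
        using c[OF q] x(1,3) q by (subst q.twisted_prod_single) (auto simp: per_def)
      also have "\<dots> = \<rho> q g \<otimes>\<^bsub>T q\<^esub> twisted_prod (T q) (\<rho> q) \<psi> (c q) (x r) \<otimes>\<^bsub>T q\<^esub>
          inv\<^bsub>T q\<^esub> \<rho> q ((\<psi> ^^ c q) g)"
        unfolding eq using \<psi> g x(1) r by (intro q.twisted_prod_conjugate) (auto simp: iso_def)
      also have "twisted_prod (T q) (\<rho> q) \<psi> (c q) (x r) = \<one>\<^bsub>T q\<^esub>"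
        using x(3) q r by (intro q.twisted_prod_eq_one) auto
      finally show False
        using x(2)[OF q g] g by simp
    qed
  qed
qed

section \<open>Finite-index subgroups of finitely generated groups\<close>

context group
begin

lemma rcos_eq_iff:
  assumes "subgroup N G" "x \<in> carrier G" "y \<in> carrier G"
  shows "N #> x = N #> y \<longleftrightarrow> x \<otimes> inv y \<in> N"
  using assms coset_mult_inv1[of N x y] coset_mult_inv2[of N x y] coset_join1[of N "x \<otimes> inv y"]
    coset_join2[of "x \<otimes> inv y" N] subgroup.subset[OF assms(1)] by blast

text \<open>Elements with equal values of \<open>F\<close> lie in the same coset, so there are at
  most as many cosets as values.\<close>

lemma finite_rcosetsI:
  assumes N: "subgroup N G" and fin: "finite (F ` carrier G)"
    and F: "\<And>x y. \<lbrakk>x \<in> carrier G; y \<in> carrier G; F x = F y\<rbrakk> \<Longrightarrow> x \<otimes> inv y \<in> N"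
  shows "finite (rcosets N)"
proof -
  define r where "r = (\<lambda>v. N #> (SOME x. x \<in> carrier G \<and> F x = v))"
  have "N #> x = r (F x)" if x: "x \<in> carrier G" for x
  proof -
    have "(SOME y. y \<in> carrier G \<and> F y = F x) \<in> carrier G \<and> F (SOME y. y \<in> carrier G \<and> F y = F x) = F x"
      by (rule someI[of _ x]) (use x in simp)
    then show ?thesis
      using x F by (auto simp: r_def rcos_eq_iff[OF N])
  qed
  then have "rcosets N \<subseteq> r ` F ` carrier G"
    by (auto simp: RCOSETS_def)
  then show ?thesis
    using fin finite_surj by blast
qed

lemma rcosets_translate:
  assumes N: "subgroup N G" and C: "C \<in> rcosets N" and x: "x \<in> carrier G"
  shows "C #> x \<in> rcosets N"
proof -
  obtain y where y: "y \<in> carrier G" "C = N #> y"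
    using C by (auto simp: RCOSETS_def)
  then have "C #> x = N #> (y \<otimes> x)"
    using x subgroup.subset[OF N] by (simp add: coset_mult_assoc)
  then show ?thesis
    using x y subgroup.subset[OF N] by (simp add: rcosetsI)
qed

text \<open>
  The action of \<open>G\<close> on the cosets of \<open>N\<close>, twisted by \<open>\<psi>\<^sup>k\<close>, is determined by finitely many generators,
  so two of these actions coincide.
\<close>
lemma coset_action_periodic:
  assumes fg: "finitely_generated_group G" and \<psi>: "\<psi> \<in> iso G G"
    and N: "subgroup N G" "finite (rcosets N)"
  obtains c where "c > 0"
    "\<And>x C. \<lbrakk>x \<in> carrier G; C \<in> rcosets N\<rbrakk> \<Longrightarrow> C #> (\<psi> ^^ c) x = C #> x"
proof -
  obtain A where A: "finite A" "A \<subseteq> carrier G" "generate G A = carrier G"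
    using fg by (auto simp: finitely_generated_group_def)
  have iso: "\<psi> ^^ k \<in> iso G G" for k
    by (rule funpow_iso[OF \<psi>])
  have hom: "group_hom G G (\<psi> ^^ k)" for k
    using iso[of k] by (simp add: group_hom_def group_hom_axioms_def iso_def)
  have \<psi>c: "(\<psi> ^^ k) x \<in> carrier G" if "x \<in> carrier G" for k x
    using group_hom.hom_closed[OF hom that] .
  have CG: "C \<subseteq> carrier G" if "C \<in> rcosets N" for C
    using subgroup.rcosets_carrier[OF N(1) is_group that] .
  note act = rcosets_translate[OF N(1)]
  \<comment> \<open>A table of how the \<psi>^k-images of the generators move the cosets. Only
    finitely many tables exist, so two exponents share one.\<close>
  define F where "F = (\<lambda>k. \<lambda>p \<in> A \<times> rcosets N. snd p #> (\<psi> ^^ k) (fst p))"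
  have "range F \<subseteq> A \<times> rcosets N \<rightarrow>\<^sub>E rcosets N"
    unfolding F_def using A(2) act \<psi>c by (intro image_subsetI, simp add: restrict_PiE_iff) auto
  then have "finite (range F)"
    using A(1) N(2) by (meson finite_PiE finite_SigmaI finite_subset)
  then have "\<not> inj F"
    using finite_imageD infinite_UNIV_nat by blast
  then obtain i j where ij: "i < j" "F i = F j"
    by (metis injI linorder_neqE_nat)
  have agree: "C #> (\<psi> ^^ i) x = C #> (\<psi> ^^ j) x" if "x \<in> carrier G" "C \<in> rcosets N" for x C
  proof -
    have "x \<in> generate G A"
      using that A by simp
    then show ?thesis
      using that(2)
    proof (induction arbitrary: C)
      case one
      then show ?case
        using group_hom.hom_one[OF hom] by simp
    next
      case (incl x)
      have "F i (x, C) = F j (x, C)"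
        using ij by simp
      then show ?case
        using incl by (simp add: F_def)
    next
      case (inv x)
      have x: "x \<in> carrier G"
        using inv A by blast
      \<comment> \<open>The coset that \<open>(\<psi> ^^ i) x\<close> carries to \<open>C\<close>.
        Agreement of the two actions of \<open>x\<close> at \<open>D\<close> yields agreement of the
        actions of its inverse at \<open>C\<close>.\<close>
      define D where "D = C #> inv ((\<psi> ^^ i) x)"
      have D: "D \<in> rcosets N"
        using act inv x \<psi>c by (simp add: D_def)
      have "F i (x, D) = F j (x, D)"
        using ij by simp
      then have "D #> (\<psi> ^^ j) x = D #> (\<psi> ^^ i) x"
        using inv D by (simp add: F_def)
      also have "\<dots> = C"
        using CG[OF inv(2)] x \<psi>c by (simp add: D_def coset_mult_assoc)
      finally have "C #> inv ((\<psi> ^^ j) x) = D"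
        using CG[OF D] x \<psi>c coset_mult_assoc[of D "(\<psi> ^^ j) x" "inv ((\<psi> ^^ j) x)"] by simp
      then show ?case
        using x by (simp add: D_def group_hom.hom_inv[OF hom])
    next
      case (eng x y)
      have xy: "x \<in> carrier G" "y \<in> carrier G"
        using eng A generate_in_carrier by blast+
      have "C #> (\<psi> ^^ k) (x \<otimes> y) = (C #> (\<psi> ^^ k) x) #> (\<psi> ^^ k) y" for k
        using xy CG[OF eng(5)] \<psi>c group_hom.hom_mult[OF hom] by (simp add: coset_mult_assoc)
      then show ?case
        using eng act xy \<psi>c by metis
    qed
  qed
  show thesis
  proof
    show "j - i > 0"
      using ij by simp
    fix x C assume x: "x \<in> carrier G" and C: "C \<in> rcosets N"
    \<comment> \<open>Pulling \<open>x\<close> back along \<psi>^i turns agreement of the exponents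
      \<open>i\<close> and \<open>j\<close> into agreement of 0 and \<open>j - i\<close>.\<close>
    obtain y where y: "y \<in> carrier G" "x = (\<psi> ^^ i) y"
      using iso[of i] x by (auto simp: iso_iff)
    have "(\<psi> ^^ (j - i)) x = (\<psi> ^^ j) y"
      using ij y by (metis comp_apply funpow_add le_add_diff_inverse2 less_imp_le)
    then show "C #> (\<psi> ^^ (j - i)) x = C #> x"
      using agree[OF y(1) C] y(2) by simp
  qed
qed

text \<open>\<open>N\<close> is the stabiliser of the coset \<open>N\<close>, so a power of \<psi>
  that leaves the coset action unchanged also preserves membership in \<open>N\<close>.\<close>

lemma preimage_periodic:
  assumes "finitely_generated_group G" "\<psi> \<in> iso G G" and N: "subgroup N G" and "finite (rcosets N)"
  obtains c where "c > 0" "\<And>x. x \<in> carrier G \<Longrightarrow> (\<psi> ^^ c) x \<in> N \<longleftrightarrow> x \<in> N"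
proof -
  obtain c where c: "c > 0"
    "\<And>x C. \<lbrakk>x \<in> carrier G; C \<in> rcosets N\<rbrakk> \<Longrightarrow> C #> (\<psi> ^^ c) x = C #> x"
    using coset_action_periodic assms by metis
  have fixes_iff: "N #> x = N \<longleftrightarrow> x \<in> N" if "x \<in> carrier G" for x
    using that N coset_join1 coset_join2 by blast
  have "(\<psi> ^^ c) x \<in> carrier G" if "x \<in> carrier G" for x
    using funpow_iso[OF assms(2), of c] that by (auto simp: iso_def hom_def)
  then have "(\<psi> ^^ c) x \<in> N \<longleftrightarrow> x \<in> N" if "x \<in> carrier G" for x
    using c(2)[OF that subgroup.subgroup_in_rcosets[OF N is_group]] fixes_iff that by metis
  then show thesis
    using that c(1) by blast
qed

text \<open>\<open>K\<close> is the intersection of the preimages, under all powers of \<psi>, of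
  the normal core of \<open>N\<close>. Periodicity of the coset action reduces this to the exponents
  below \<open>c\<close>, which makes the index finite.\<close>

lemma invariant_core:
  assumes fg: "finitely_generated_group G" and \<psi>: "\<psi> \<in> iso G G"
    and N: "subgroup N G" "finite (rcosets N)"
  obtains K where "K \<lhd> G" "K \<subseteq> N" "finite (rcosets K)" "\<And>x. x \<in> carrier G \<Longrightarrow> \<psi> x \<in> K \<longleftrightarrow> x \<in> K"
proof -
  obtain c where c: "c > 0"
    "\<And>x C. \<lbrakk>x \<in> carrier G; C \<in> rcosets N\<rbrakk> \<Longrightarrow> C #> (\<psi> ^^ c) x = C #> x"
    using coset_action_periodic[OF assms] by metis
  have iso: "\<psi> ^^ k \<in> iso G G" for k
    by (rule funpow_iso[OF \<psi>])
  have hom: "group_hom G G (\<psi> ^^ k)" for k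
    using iso[of k] by (simp add: group_hom_def group_hom_axioms_def iso_def)
  have \<psi>c: "(\<psi> ^^ k) x \<in> carrier G" if "x \<in> carrier G" for k x
    using group_hom.hom_closed[OF hom that] .
  have \<psi>c1: "\<psi> x \<in> carrier G" if "x \<in> carrier G" for x
    using \<psi>c[of x 1] that by simp
  have CG: "C \<subseteq> carrier G" if "C \<in> rcosets N" for C
    using subgroup.rcosets_carrier[OF N(1) is_group that] .
  note act = rcosets_translate[OF N(1)]
  define K where "K = {x \<in> carrier G. \<forall>k. \<forall>C \<in> rcosets N. C #> (\<psi> ^^ k) x = C}"
  have act_mult: "C #> (\<psi> ^^ k) (x \<otimes> y) = (C #> (\<psi> ^^ k) x) #> (\<psi> ^^ k) y"
    if "x \<in> carrier G" "y \<in> carrier G" "C \<in> rcosets N" for C x y k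
    using that CG \<psi>c by (simp add: coset_mult_assoc group_hom.hom_mult[OF hom])
  have act_inv: "C #> (\<psi> ^^ k) (inv x) = D"
    if "x \<in> carrier G" "C \<in> rcosets N" "D \<in> rcosets N" "D #> (\<psi> ^^ k) x = C" for C D x k
  proof -
    have "C #> (\<psi> ^^ k) (inv x) = D #> (\<psi> ^^ k) (x \<otimes> inv x)"
      using that act_mult[of x "inv x" D k] by simp
    then show ?thesis
      using that(1) CG[OF that(3)] group_hom.hom_one[OF hom] by simp
  qed
  have "subgroup K G"
  proof
    show "\<one> \<in> K"
      using CG group_hom.hom_one[OF hom] by (simp add: K_def)
    fix x y assume "x \<in> K" "y \<in> K"
    then show "x \<otimes> y \<in> K"
      by (simp add: K_def act_mult)
  next
    fix x assume "x \<in> K"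
    then show "inv x \<in> K"
      using act_inv by (auto simp: K_def)
  qed (auto simp: K_def)
  then have "K \<lhd> G"
  proof (subst normal_inv_iff, intro conjI ballI)
    fix x h assume x: "x \<in> carrier G" and h: "h \<in> K"
    have "C #> (\<psi> ^^ k) (x \<otimes> h \<otimes> inv x) = C" if C: "C \<in> rcosets N" for C k
    proof -
      have D: "C #> (\<psi> ^^ k) x \<in> rcosets N"
        using act C \<psi>c x by simp
      have "C #> (\<psi> ^^ k) (x \<otimes> h \<otimes> inv x) = (C #> (\<psi> ^^ k) x) #> (\<psi> ^^ k) (inv x)"
        using x h C D by (simp add: act_mult K_def)
      also have "\<dots> = C"
        using act_inv[OF x D C] by simp
      finally show ?thesis .
    qed
    then show "x \<otimes> h \<otimes> inv x \<in> K"
      using x h by (simp add: K_def)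
  qed
  moreover have "K \<subseteq> N"
  proof
    fix x assume "x \<in> K"
    then have "x \<in> carrier G" "N #> (\<psi> ^^ 0) x = N"
      using subgroup.subgroup_in_rcosets[OF N(1) is_group] unfolding K_def by blast+
    then show "x \<in> N"
      using coset_join1 N(1) by simp
  qed
  moreover have "\<psi> x \<in> K \<longleftrightarrow> x \<in> K" if x: "x \<in> carrier G" for x
  proof
    assume "x \<in> K"
    then have "C #> (\<psi> ^^ Suc k) x = C" if "C \<in> rcosets N" for C k
      using that unfolding K_def by blast
    then show "\<psi> x \<in> K"
      using x \<psi>c1 by (auto simp: K_def funpow_swap1)
  next
    assume \<psi>x: "\<psi> x \<in> K"
    have shift: "C #> (\<psi> ^^ Suc k) x = C" if "C \<in> rcosets N" for C k
      using \<psi>x that by (simp add: K_def funpow_swap1)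
    \<comment> \<open>Only the exponent 0 is missing from \<open>shift\<close>; it is supplied by
      the exponent \<open>c\<close>, which acts in the same way.\<close>
    have "C #> (\<psi> ^^ k) x = C" if "C \<in> rcosets N" for C k
    proof (cases k)
      case 0
      then show ?thesis
        using c(2)[OF x that] shift[OF that, of "c - 1"] c(1) by simp
    next
      case (Suc m)
      then show ?thesis
        using shift[OF that] by simp
    qed
    then show "x \<in> K"
      using x by (simp add: K_def)
  qed
  moreover have "finite (rcosets K)"
  proof (rule finite_rcosetsI)
    \<comment> \<open>The actions for exponents below \<open>c\<close> determine those for all
      exponents, so elements with equal tables differ by an element of \<open>K\<close>.\<close>
    let ?F = "\<lambda>x. \<lambda>p \<in> {..<c} \<times> rcosets N. snd p #> (\<psi> ^^ fst p) x"
    have "?F ` carrier G \<subseteq> {..<c} \<times> rcosets N \<rightarrow>\<^sub>E rcosets N"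
      using act \<psi>c by (intro image_subsetI, simp add: restrict_PiE_iff) auto
    then show "finite (?F ` carrier G)"
      by (rule finite_subset) (use N(2) in \<open>intro finite_PiE finite_SigmaI, auto\<close>)
    fix x y assume x: "x \<in> carrier G" and y: "y \<in> carrier G" and eq: "?F x = ?F y"
    have small: "C #> (\<psi> ^^ k) x = C #> (\<psi> ^^ k) y" if "k < c" "C \<in> rcosets N" for k C
      using fun_cong[OF eq, of "(k, C)"] that by simp
    have reduce: "C #> (\<psi> ^^ k) z = C #> (\<psi> ^^ (k mod c)) z" if z: "z \<in> carrier G" and C: "C \<in> rcosets N" for z C k
    proof (induction k rule: less_induct)
      case (less k)
      show ?case
      proof (cases "k < c")
        case False
        then have "C #> (\<psi> ^^ k) z = C #> (\<psi> ^^ c) ((\<psi> ^^ (k - c)) z)"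
          by (metis comp_apply funpow_add le_add_diff_inverse not_less)
        also have "\<dots> = C #> (\<psi> ^^ (k - c)) z"
          using c(2) \<psi>c z C by simp
        also have "\<dots> = C #> (\<psi> ^^ (k mod c)) z"
          using less[of "k - c"] False c(1) by (simp add: le_mod_geq)
        finally show ?thesis .
      qed simp
    qed
    have all: "C #> (\<psi> ^^ k) x = C #> (\<psi> ^^ k) y" if "C \<in> rcosets N" for k C
      using small[of "k mod c" C] that c(1) reduce[OF x that, of k] reduce[OF y that, of k] by simp
    have "C #> (\<psi> ^^ k) (x \<otimes> inv y) = C" if C: "C \<in> rcosets N" for k C
    proof -
      have D: "C #> (\<psi> ^^ k) y \<in> rcosets N"
        using act \<psi>c y C by simp
      have "C #> (\<psi> ^^ k) (x \<otimes> inv y) = (C #> (\<psi> ^^ k) y) #> (\<psi> ^^ k) (inv y)"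
        using act_mult[of x "inv y" C k] all[OF C, of k] x y C by simp
      also have "\<dots> = C"
        using act_inv[OF y D C] by simp
      finally show ?thesis .
    qed
    then show "x \<otimes> inv y \<in> K"
      using x y by (simp add: K_def)
  qed (rule \<open>subgroup K G\<close>)
  ultimately show thesis
    using that by blast
qed

text \<open>
  Each \<open>\<psi>\<close>-class of \<open>G\<close> is a union of at most \<open>[G : K]\<close> orbits of \<open>K\<close>.
\<close>
lemma twisted_classes_bound:
  assumes \<psi>: "\<psi> \<in> hom G G" and K: "subgroup K G" "finite (rcosets K)"
    and fin: "finite (carrier G // twisted_conj G \<psi>)"
    and Y: "Y \<subseteq> carrier G"
      "\<And>x y g. \<lbrakk>x \<in> Y; y \<in> Y; x \<noteq> y; g \<in> K\<rbrakk> \<Longrightarrow> x \<noteq> g \<otimes> y \<otimes> inv (\<psi> g)"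
  shows "card Y \<le> card (carrier G // twisted_conj G \<psi>) * card (rcosets K)"
proof -
  interpret \<psi>: group_hom G G \<psi>
    using \<psi> by unfold_locales
  let ?R = "twisted_conj G \<psi>"
  define rep :: "'a set \<Rightarrow> 'a" where "rep = (\<lambda>C. SOME y. y \<in> C)"
  \<comment> \<open>\<open>h x\<close> carries the chosen representative of the class of
    \<open>x\<close> to \<open>x\<close>. If \<open>x\<close> and \<open>y\<close> share both the
    class and the coset \<open>K #> h x\<close>, then \<open>h x \<otimes> inv (h y)\<close> lies in
    \<open>K\<close> and carries \<open>y\<close> to \<open>x\<close>.\<close>
  define h where "h = (\<lambda>x. SOME g. g \<in> carrier G \<and> x = g \<otimes> rep (?R `` {x}) \<otimes> inv (\<psi> g))"
  have rep: "rep (?R `` {x}) \<in> carrier G"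
    and h: "h x \<in> carrier G" "x = h x \<otimes> rep (?R `` {x}) \<otimes> inv (\<psi> (h x))" if x: "x \<in> carrier G" for x
  proof -
    have "x \<in> ?R `` {x}"
      using x by (auto simp: twisted_conj_def intro!: bexI[of _ \<one>])
    then have "rep (?R `` {x}) \<in> ?R `` {x}"
      unfolding rep_def by (rule someI)
    then show "rep (?R `` {x}) \<in> carrier G"
      by (auto simp: twisted_conj_def)
    from \<open>rep (?R `` {x}) \<in> ?R `` {x}\<close>
    have "\<exists>g. g \<in> carrier G \<and> x = g \<otimes> rep (?R `` {x}) \<otimes> inv (\<psi> g)"
      by (auto simp: twisted_conj_def)
    then have "h x \<in> carrier G \<and> x = h x \<otimes> rep (?R `` {x}) \<otimes> inv (\<psi> (h x))"
      unfolding h_def by (rule someI_ex)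
    then show "h x \<in> carrier G" "x = h x \<otimes> rep (?R `` {x}) \<otimes> inv (\<psi> (h x))"
      by blast+
  qed
  have "inj_on (\<lambda>x. (?R `` {x}, K #> h x)) Y"
  proof (rule inj_onI, rule ccontr)
    fix x y assume xy: "x \<in> Y" "y \<in> Y" "x \<noteq> y" and eq: "(?R `` {x}, K #> h x) = (?R `` {y}, K #> h y)"
    define r where "r = rep (?R `` {x})"
    define k where "k = h x \<otimes> inv (h y)"
    have xyG: "x \<in> carrier G" "y \<in> carrier G"
      using xy Y by auto
    have hr: "h x \<in> carrier G" "h y \<in> carrier G" "r \<in> carrier G"
      using h rep xyG by (auto simp: r_def)
    have x: "x = h x \<otimes> r \<otimes> inv (\<psi> (h x))" and y: "y = h y \<otimes> r \<otimes> inv (\<psi> (h y))"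
      using h(2)[OF xyG(1)] h(2)[OF xyG(2)] eq by (simp_all add: r_def)
    have kK: "k \<in> K"
      using eq hr by (simp add: k_def rcos_eq_iff[OF K(1)])
    have kG: "k \<in> carrier G" and hx: "h x = k \<otimes> h y"
      using hr by (simp_all add: k_def m_assoc)
    have "x = k \<otimes> (h y \<otimes> r \<otimes> inv (\<psi> (h y))) \<otimes> inv (\<psi> k)"
      using kG hr by (subst x) (simp add: hx m_assoc inv_mult_group)
    then have "x = k \<otimes> y \<otimes> inv (\<psi> k)"
      by (simp only: y[symmetric])
    then show False
      using Y(2) xy kK by blast
  qed
  moreover have "(\<lambda>x. (?R `` {x}, K #> h x)) ` Y \<subseteq> (carrier G // ?R) \<times> (rcosets K)"
    using Y(1) h subgroup.subset[OF K(1)] by (auto intro: quotientI rcosetsI)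
  ultimately have "card Y \<le> card ((carrier G // ?R) \<times> (rcosets K))"
    using fin K(2) by (intro card_inj_on_le) auto
  then show ?thesis
    by (simp add: card_cartesian_product)
qed

end

section \<open>The \<open>R\<^sub>\<infinity>\<close>-property\<close>

lemma finite_alt_group: "finite (carrier (alt_group n))"
  by (rule finite_subset[OF _ finite_permutations[of "{1..n}"]]) (auto simp: alt_group_carrier)

lemma alt_group_twist_separating:
  assumes "Factorial_Ring.prime q" "q \<ge> 3"
  shows "twist_separating (alt_group (q + 2))"
proof -
  obtain x where "x \<in> carrier (alt_group (q + 2))"
    "x [^]\<^bsub>alt_group (q + 2)\<^esub> q = \<one>\<^bsub>alt_group (q + 2)\<^esub>" "x \<noteq> \<one>\<^bsub>alt_group (q + 2)\<^esub>"
    using alt_group_prime_order_element[OF assms] by blast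
  then show ?thesis
    unfolding twist_separating_def using alt_group_prime_order_conjugate[OF assms] by blast
qed

text \<open>Write \<open>x\<close> as an element of \<open>K\<close> times the chosen representative
  \<open>r (K #> x)\<close>. The coset of \<open>K\<close> and the value of \<rho> on the first
  factor range over finite sets and together determine the coset of the kernel.\<close>

lemma (in group) finite_rcosets_kernel:
  assumes K: "subgroup K G" "finite (rcosets K)"
    and \<rho>: "group_hom (G\<lparr>carrier := K\<rparr>) T \<rho>" and fin: "finite (carrier T)"
  shows "finite (rcosets (kernel (G\<lparr>carrier := K\<rparr>) T \<rho>))"
proof -
  interpret \<rho>: group_hom "G\<lparr>carrier := K\<rparr>" T \<rho> by (rule \<rho>)
  have KG: "K \<subseteq> carrier G"
    using subgroup.subset[OF K(1)] .
  have N: "subgroup (kernel (G\<lparr>carrier := K\<rparr>) T \<rho>) G"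
    using \<rho>.subgroup_kernel incl_subgroup[OF K(1)] by blast
  define r :: "'a set \<Rightarrow> 'a" where "r = (\<lambda>C. SOME x. x \<in> carrier G \<and> K #> x = C)"
  have r: "r (K #> x) \<in> carrier G" "x \<otimes> inv r (K #> x) \<in> K" if x: "x \<in> carrier G" for x
  proof -
    have "r (K #> x) \<in> carrier G \<and> K #> r (K #> x) = K #> x"
      unfolding r_def by (rule someI[of _ x]) (use x in simp)
    then show "r (K #> x) \<in> carrier G" "x \<otimes> inv r (K #> x) \<in> K"
      using rcos_eq_iff[OF K(1) x, of "r (K #> x)"] by auto
  qed
  let ?F = "\<lambda>x. (K #> x, \<rho> (x \<otimes> inv r (K #> x)))"
  show ?thesis
  proof (rule finite_rcosetsI[OF N])
    have "?F ` carrier G \<subseteq> (rcosets K) \<times> carrier T"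
      using r KG \<rho>.hom_closed by (auto intro: rcosetsI)
    then show "finite (?F ` carrier G)"
      using K(2) fin finite_subset by blast
    fix x y assume x: "x \<in> carrier G" and y: "y \<in> carrier G" and eq: "?F x = ?F y"
    define s where "s = r (K #> x)"
    have s: "s \<in> carrier G" "x \<otimes> inv s \<in> K" "y \<otimes> inv s \<in> K"
      using r[OF x] r[OF y] eq by (simp_all add: s_def)
    have "\<rho> (x \<otimes> inv s) = \<rho> (y \<otimes> inv s)"
      using eq by (auto simp: s_def)
    moreover have "x \<otimes> inv y \<in> K"
      using eq x y by (simp add: rcos_eq_iff[OF K(1), symmetric])
    moreover have "x \<otimes> inv s = (x \<otimes> inv y) \<otimes> (y \<otimes> inv s)"
      using x y s(1) by (simp add: m_assoc inv_solve_left)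
    ultimately have "\<rho> (x \<otimes> inv y) \<otimes>\<^bsub>T\<^esub> \<rho> (y \<otimes> inv s) = \<rho> (y \<otimes> inv s)"
      using \<rho>.hom_mult[of "x \<otimes> inv y" "y \<otimes> inv s"] s by simp
    then have "\<rho> (x \<otimes> inv y) = \<one>\<^bsub>T\<^esub>"
      using \<rho>.hom_closed[of "x \<otimes> inv y"] \<rho>.hom_closed[of "y \<otimes> inv s"] s \<open>x \<otimes> inv y \<in> K\<close>
      by simp
    then show "x \<otimes> inv y \<in> kernel (G\<lparr>carrier := K\<rparr>) T \<rho>"
      using \<open>x \<otimes> inv y \<in> K\<close> by (simp add: kernel_def)
  qed
qed

lemma (in group) pow_card_rcosets_mem:
  assumes K: "K \<lhd> G" and fin: "finite (rcosets K)" and x: "x \<in> carrier G"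
  shows "x [^] card (rcosets K) \<in> K"
proof -
  interpret K: normal K G by (rule K)
  interpret Q: group "G Mod K" by (rule K.factorgroup_is_group)
  have "K #> x \<in> carrier (G Mod K)"
    using x by (auto simp: carrier_FactGroup)
  then have "(K #> x) [^]\<^bsub>G Mod K\<^esub> card (rcosets K) = K"
    using Q.pow_order_eq_1[of "K #> x"] by (simp add: order_def FactGroup_def)
  then have "K #> (x [^] card (rcosets K)) = K"
    using K.FactGroup_pow[OF x] by simp
  then show ?thesis
    using coset_join1 x K.subgroup_axioms by simp
qed

text \<open>The image of \<open>K\<close> contains the \<open>d\<close>-th power of an element of order \<open>q > d\<close>,
  so it is a nontrivial normal subgroup.\<close>
lemma (in group) alt_group_image_finite_index:
  assumes L: "subgroup L G" and K: "K \<lhd> G" "K \<subseteq> L" "finite (rcosets K)"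
    and q: "Factorial_Ring.prime q" "q \<ge> 3" "q > card (rcosets K)"
    and \<rho>: "\<rho> \<in> hom (G\<lparr>carrier := L\<rparr>) (alt_group (q + 2))" "\<rho> ` L = carrier (alt_group (q + 2))"
  shows "\<rho> ` K = carrier (alt_group (q + 2))"
proof -
  interpret A: simple_group "alt_group (q + 2)"
    using q by (intro simple_group_alt_group) simp
  interpret L: group "G\<lparr>carrier := L\<rparr>"
    using subgroup_imp_group[OF L] .
  interpret \<rho>: group_hom "G\<lparr>carrier := L\<rparr>" "alt_group (q + 2)" \<rho>
    using \<rho> by unfold_locales
  let ?d = "card (rcosets K)"
  have d: "?d > 0"
    using K(3) subgroup.subgroup_in_rcosets[OF normal_imp_subgroup[OF K(1)] is_group]
    by (auto simp: card_gt_0_iff)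
  obtain x0 where x0: "x0 \<in> carrier (alt_group (q + 2))"
    "x0 [^]\<^bsub>alt_group (q + 2)\<^esub> q = \<one>\<^bsub>alt_group (q + 2)\<^esub>" "x0 \<noteq> \<one>\<^bsub>alt_group (q + 2)\<^esub>"
    using alt_group_prime_order_element[OF q(1,2)] by blast
  obtain l where l: "l \<in> L" "\<rho> l = x0"
    using x0(1) \<rho>(2) by (metis imageE)
  have lG: "l \<in> carrier G"
    using l subgroup.mem_carrier[OF L] by blast
  have "l [^] ?d \<in> K"
    using pow_card_rcosets_mem[OF K(1,3) lG] .
  moreover have "\<rho> (l [^] ?d) = x0 [^]\<^bsub>alt_group (q + 2)\<^esub> ?d"
    using \<rho>.hom_nat_pow[of l ?d] l by (simp add: nat_pow_consistent[symmetric])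
  moreover have "x0 [^]\<^bsub>alt_group (q + 2)\<^esub> ?d \<noteq> \<one>\<^bsub>alt_group (q + 2)\<^esub>"
  proof
    assume "x0 [^]\<^bsub>alt_group (q + 2)\<^esub> ?d = \<one>\<^bsub>alt_group (q + 2)\<^esub>"
    then have "A.ord x0 dvd ?d" "A.ord x0 dvd q"
      using A.pow_eq_id[OF x0(1)] x0(2) by auto
    \<comment> \<open>The prime \<open>q\<close> exceeds the positive index, so it cannot divide
      it.\<close>
    moreover have "coprime ?d q"
      using q d by (metis coprime_commute nat_dvd_not_less prime_imp_coprime_nat)
    ultimately have "A.ord x0 = 1"
      using coprime_common_divisor_nat by blast
    then show False
      using A.ord_eq_1[OF x0(1)] x0(3) by simp
  qed
  moreover have "\<rho> ` K \<lhd> alt_group (q + 2)"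
    using normal.surj_hom_normal_subgroup[OF normal_restrict_supergroup[OF L K(1,2)] \<rho>.group_hom_axioms] \<rho>(2)
    by simp
  ultimately show ?thesis
    using A.no_real_normal_subgroup[of "\<rho> ` K"] by (metis imageI singletonD)
qed

text \<open>If there were finitely many classes, their number times the index of \<open>K\<close>
  would bound every subset of \<open>G\<close> that is pairwise inequivalent under twisting by
  \<open>K\<close>. Taking one more prime than this bound, all larger than the index, gives a family
  that is too large.\<close>

theorem R_infinity_of_alternating_quotients:
  fixes G (structure)
  assumes fg: "finitely_generated_group G" and L: "subgroup L G" "finite (rcosets L)"
    and alt: "\<And>q. \<lbrakk>Factorial_Ring.prime q; q \<ge> 3\<rbrakk> \<Longrightarrow>
      \<exists>\<rho> \<in> hom (G\<lparr>carrier := L\<rparr>) (alt_group (q + 2)). \<rho> ` L = carrier (alt_group (q + 2))"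
  shows "R_infinity G"
  unfolding R_infinity_def
proof (intro ballI notI)
  interpret group G
    using fg by (simp add: finitely_generated_group_def)
  fix \<psi> assume \<psi>: "\<psi> \<in> iso G G" and fin: "finite (carrier G // twisted_conj G \<psi>)"
  obtain K where K: "K \<lhd> G" "K \<subseteq> L" "finite (rcosets K)" and \<psi>K: "\<And>x. x \<in> carrier G \<Longrightarrow> \<psi> x \<in> K \<longleftrightarrow> x \<in> K"
    using invariant_core[OF fg \<psi> L] by metis
  define d where "d = card (rcosets K)"
  define b where "b = card (carrier G // twisted_conj G \<psi>) * d"
  define P where "P = {q :: nat. Factorial_Ring.prime q \<and> q \<ge> 3 \<and> q > d}"
  have "infinite P"
  proof
    assume "finite P"
    moreover have "{q :: nat. Factorial_Ring.prime q} \<subseteq> P \<union> {..max 2 d}"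
      by (auto simp: P_def)
    ultimately show False
      using primes_infinite finite_subset by blast
  qed
  then obtain Q where Q: "Q \<subseteq> P" "card Q = Suc b" "finite Q"
    using infinite_arbitrarily_large by metis
  have subK: "subgroup K G"
    using K(1) by (rule normal_imp_subgroup)
  have KG: "K \<subseteq> carrier G"
    using subgroup.subset[OF subK] .
  let ?K = "G\<lparr>carrier := K\<rparr>"
  interpret K: group ?K
    by (rule subgroup_imp_group[OF subK])
  have \<psi>K': "\<psi> \<in> iso ?K ?K"
  proof -
    have "\<psi> ` K = K"
    proof
      show "\<psi> ` K \<subseteq> K"
        using \<psi>K KG by blast
      show "K \<subseteq> \<psi> ` K"
      proof
        fix x assume x: "x \<in> K"
        then obtain y where "y \<in> carrier G" "x = \<psi> y"
          using \<psi> KG by (auto simp: iso_iff)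
        then show "x \<in> \<psi> ` K"
          using x \<psi>K by auto
      qed
    qed
    then show ?thesis
      using \<psi> KG by (auto simp: iso_iff hom_def inj_on_def subset_iff)
  qed
  have "\<exists>\<rho>. \<rho> \<in> hom ?K (alt_group (q + 2)) \<and> \<rho> ` K = carrier (alt_group (q + 2))" if "q \<in> Q" for q
  proof -
    have q: "Factorial_Ring.prime q" "q \<ge> 3" "q > card (rcosets K)"
      using that Q(1) by (auto simp: P_def d_def)
    then obtain \<rho> where \<rho>: "\<rho> \<in> hom (G\<lparr>carrier := L\<rparr>) (alt_group (q + 2))" "\<rho> ` L = carrier (alt_group (q + 2))"
      using alt by blast
    then have "\<rho> \<in> hom ?K (alt_group (q + 2))"
      using subsetD[OF K(2)] by (simp add: hom_def Pi_iff)
    then show ?thesis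
      using alt_group_image_finite_index[OF L(1) K q \<rho>] by blast
  qed
  then obtain \<rho> where \<rho>: "\<And>q. q \<in> Q \<Longrightarrow> \<rho> q \<in> hom ?K (alt_group (q + 2))"
    "\<And>q. q \<in> Q \<Longrightarrow> \<rho> q ` K = carrier (alt_group (q + 2))"
    by metis
  have periodic: "\<exists>c > 0. \<forall>x \<in> carrier ?K. \<rho> q ((\<psi> ^^ c) x) = \<one>\<^bsub>alt_group (q + 2)\<^esub> \<longleftrightarrow> \<rho> q x = \<one>\<^bsub>alt_group (q + 2)\<^esub>"
    if q: "q \<in> Q" for q
  proof -
    interpret \<rho>: group_hom ?K "alt_group (q + 2)" "\<rho> q"
      using \<rho>(1)[OF q] K.is_group alt_group_is_group[of "q + 2"]
      by (simp add: group_hom_def group_hom_axioms_def)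
    \<comment> \<open>Regarded in \<open>G\<close>, this kernel has finite index, so its periodicity
      follows from finite generation of \<open>G\<close> itself.\<close>
    define N where "N = kernel ?K (alt_group (q + 2)) (\<rho> q)"
    have N: "subgroup N G"
      using \<rho>.subgroup_kernel incl_subgroup[OF subK] by (simp add: N_def)
    have "finite (rcosets N)"
      unfolding N_def by (rule finite_rcosets_kernel[OF subK K(3) \<rho>.group_hom_axioms finite_alt_group])
    then obtain c where c: "c > 0" "\<And>x. x \<in> carrier G \<Longrightarrow> (\<psi> ^^ c) x \<in> N \<longleftrightarrow> x \<in> N"
      using preimage_periodic[OF fg \<psi> N] by metis
    have "(\<psi> ^^ c) x \<in> K" if "x \<in> K" for x
      using funpow_iso[OF \<psi>K', of c] that by (auto simp: iso_def hom_def)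
    then have "\<rho> q ((\<psi> ^^ c) x) = \<one>\<^bsub>alt_group (q + 2)\<^esub> \<longleftrightarrow> \<rho> q x = \<one>\<^bsub>alt_group (q + 2)\<^esub>" if "x \<in> K" for x
      using c(2)[of x] that KG by (auto simp: N_def kernel_def)
    then show ?thesis
      using c(1) by auto
  qed
  have q3: "Factorial_Ring.prime q" "q \<ge> 3" if "q \<in> Q" for q
    using that Q(1) by (auto simp: P_def)
  have "\<exists>x \<in> Q \<rightarrow> carrier ?K. \<forall>q \<in> Q. \<forall>r \<in> Q - {q}. \<forall>g \<in> carrier ?K.
      x q \<noteq> g \<otimes>\<^bsub>?K\<^esub> x r \<otimes>\<^bsub>?K\<^esub> inv\<^bsub>?K\<^esub> (\<psi> g)"
  proof (rule twisted_inequivalent_family[OF K.is_group \<psi>K' Q(3)])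
    fix q assume q: "q \<in> Q"
    show "simple_group (alt_group (q + 2))"
      using q3[OF q] by (intro simple_group_alt_group) simp
    show "finite (carrier (alt_group (q + 2)))"
      by (rule finite_alt_group)
    show "derived (alt_group (q + 2)) (carrier (alt_group (q + 2))) = carrier (alt_group (q + 2))"
      using q3[OF q] by (intro derived_alt_group_const) simp
    show "twist_separating (alt_group (q + 2))"
      using alt_group_twist_separating q3[OF q] by blast
    show "\<rho> q \<in> hom ?K (alt_group (q + 2))" "\<rho> q ` carrier ?K = carrier (alt_group (q + 2))"
      using \<rho>[OF q] by simp_all
    show "\<exists>c > 0. \<forall>x \<in> carrier ?K. \<rho> q ((\<psi> ^^ c) x) = \<one>\<^bsub>alt_group (q + 2)\<^esub> \<longleftrightarrow> \<rho> q x = \<one>\<^bsub>alt_group (q + 2)\<^esub>"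
      by (rule periodic[OF q])
  next
    show "inj_on (\<lambda>q. card (carrier (alt_group (q + 2)))) Q"
    proof (rule inj_onI)
      fix q r assume "card (carrier (alt_group (q + 2))) = card (carrier (alt_group (r + 2)))"
      then have "q + 2 = r + 2"
        by (rule alt_group_card_inj[rotated 2]) simp_all
      then show "q = r" by simp
    qed
  qed
  then obtain x where x: "x \<in> Q \<rightarrow> K"
    "\<And>q r g. \<lbrakk>q \<in> Q; r \<in> Q; q \<noteq> r; g \<in> K\<rbrakk> \<Longrightarrow> x q \<noteq> g \<otimes> x r \<otimes> inv\<^bsub>?K\<^esub> (\<psi> g)"
    by fastforce
  have xK: "x q \<in> K" if "q \<in> Q" for q
    using x(1) that by auto
  have sep: "x q \<noteq> g \<otimes> x r \<otimes> inv (\<psi> g)" if "q \<in> Q" "r \<in> Q" "q \<noteq> r" "g \<in> K" for q r g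
    using x(2)[of q r g] that \<psi>K KG m_inv_consistent[OF subK, of "\<psi> g"] by auto
  have "inj_on x Q"
  proof (rule inj_onI, rule ccontr)
    fix q r assume "q \<in> Q" "r \<in> Q" "x q = x r" "q \<noteq> r"
    moreover have "\<psi> \<one> = \<one>"
      using \<psi> hom_one[of \<psi> G G] is_group by (simp add: iso_def)
    ultimately show False
      using sep[of q r \<one>] xK[of r] KG subgroup.one_closed[OF subK] by auto
  qed
  then have "card (x ` Q) = Suc b"
    using Q(2) by (simp add: card_image)
  moreover have "card (x ` Q) \<le> b"
    unfolding b_def d_def
  proof (rule twisted_classes_bound[OF _ subK K(3) fin])
    show "\<psi> \<in> hom G G"
      using \<psi> by (simp add: iso_def)
    show "x ` Q \<subseteq> carrier G"
      using xK KG by blast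
    fix u v g assume "u \<in> x ` Q" "v \<in> x ` Q" "u \<noteq> v" "g \<in> K"
    then obtain q r where "u = x q" "v = x r" "q \<in> Q" "r \<in> Q" "q \<noteq> r"
      by auto
    then show "u \<noteq> g \<otimes> v \<otimes> inv (\<psi> g)"
      using sep \<open>g \<in> K\<close> by simp
  qed
  ultimately show False
    by simp
qed

section \<open>Application to products of virtually free groups\<close>

lemma free_group_onto_alt_group:
  assumes F: "group F" and S: "free_basis F S" and ab: "a \<in> S" "b \<in> S" "a \<noteq> b"
    and n: "n \<ge> 5" "odd n"
  shows "\<exists>h \<in> hom F (alt_group n). h ` carrier F = carrier (alt_group n)"
proof -
  let ?x = "cycle_of_list [1, 2, 3 :: nat]" and ?y = "cycle_of_list [1..<Suc n]"
  interpret A: group "alt_group n"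
    by (rule alt_group_is_group)
  note gens = alt_group_two_generators[OF n]
  \<comment> \<open>Two basis elements go to the two generators, which already gives surjectivity;
    the identity is a default for the others.\<close>
  define f where "f = (\<lambda>s. if s = a then ?x else if s = b then ?y else \<one>\<^bsub>alt_group n\<^esub>)"
  have "f \<in> S \<rightarrow> carrier (alt_group n)"
    using gens(1,2) by (simp add: f_def del: cycle_of_list.simps upt_Suc)
  then obtain h where h: "h \<in> hom F (alt_group n)" "\<And>s. s \<in> S \<Longrightarrow> h s = f s"
    using free_basis_extend_hom[OF F S alt_group_is_group] by metis
  interpret h: group_hom F "alt_group n" h
    using F h(1) by (simp add: group_hom_def group_hom_axioms_def)
  have "a \<in> carrier F" "b \<in> carrier F"
    using S ab by (auto simp: free_basis_def)
  moreover have "h a = ?x" "h b = ?y"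
    using h(2) ab by (simp_all add: f_def del: cycle_of_list.simps upt_Suc)
  ultimately have "{?x, ?y} \<subseteq> h ` carrier F"
    by (metis empty_subsetI imageI insert_subset)
  then have "generate (alt_group n) {?x, ?y} \<subseteq> h ` carrier F"
    by (rule A.generate_subgroup_incl) (rule h.img_is_subgroup)
  then have "h ` carrier F = carrier (alt_group n)"
    using gens(3) h.hom_closed by auto
  then show ?thesis
    using h(1) by blast
qed

lemma finitely_generated_product_group:
  assumes I: "finite I" and G: "\<And>i. i \<in> I \<Longrightarrow> finitely_generated_group (G i)"
  shows "finitely_generated_group (product_group I G)"
proof -
  let ?P = "product_group I G"
  have grp: "group (G i)" if "i \<in> I" for i
    using G[OF that] by (simp add: finitely_generated_group_def)
  interpret P: group ?P
    using grp by (rule product_group)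
  have "\<forall>i \<in> I. \<exists>A. finite A \<and> A \<subseteq> carrier (G i) \<and> generate (G i) A = carrier (G i)"
    using G by (simp add: finitely_generated_group_def)
  then obtain A where A: "\<And>i. i \<in> I \<Longrightarrow> finite (A i)" "\<And>i. i \<in> I \<Longrightarrow> A i \<subseteq> carrier (G i)"
    "\<And>i. i \<in> I \<Longrightarrow> generate (G i) (A i) = carrier (G i)"
    by metis
  \<comment> \<open>The inclusion of the factor with index \<open>i\<close>, with identity entries
    in the other coordinates.\<close>
  define e where "e = (\<lambda>i a. \<lambda>j\<in>I. if j = i then a else \<one>\<^bsub>G j\<^esub>)"
  have one: "\<one>\<^bsub>G i\<^esub> \<in> carrier (G i)" if "i \<in> I" for i
    using grp[OF that] by (simp add: group.is_monoid)
  have e: "group_hom (G i) ?P (e i)" if "i \<in> I" for i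
  proof -
    have "e i \<in> hom (G i) ?P"
      using that one grp by (auto simp: hom_def e_def fun_eq_iff group.is_monoid)
    then show ?thesis
      using grp[OF that] P.is_group by (simp add: group_hom_def group_hom_axioms_def)
  qed
  define B where "B = (\<Union>i\<in>I. e i ` A i)"
  have sub: "B \<subseteq> carrier ?P"
    unfolding B_def
  proof (intro UN_least image_subsetI)
    fix i a assume i: "i \<in> I" and a: "a \<in> A i"
    show "e i a \<in> carrier ?P"
      using group_hom.hom_closed[OF e[OF i] subsetD[OF A(2)[OF i] a]] .
  qed
  have e_gen: "e i a \<in> generate ?P B" if "i \<in> I" "a \<in> carrier (G i)" for i a
  proof -
    have "e i ` generate (G i) (A i) = generate ?P (e i ` A i)"
      using group_hom.generate_img[OF e A(2)] that(1) by simp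
    moreover have "generate ?P (e i ` A i) \<subseteq> generate ?P B"
      using that(1) by (intro P.mono_generate) (auto simp: B_def)
    ultimately show ?thesis
      using A(3) that by blast
  qed
  \<comment> \<open>Induction on the set \<open>J\<close> of coordinates where \<open>f\<close> may
    be nontrivial: splitting off \<open>e j (f j)\<close> resets coordinate \<open>j\<close> to the
    identity.\<close>
  have "f \<in> generate ?P B"
    if "J \<subseteq> I" "f \<in> carrier ?P" "\<And>i. i \<in> I - J \<Longrightarrow> f i = \<one>\<^bsub>G i\<^esub>" for J f
    using finite_subset[OF that(1) I] that
  proof (induction J arbitrary: f)
    case empty
    then have f_one: "f = \<one>\<^bsub>?P\<^esub>"
      by (auto simp: PiE_iff extensional_def fun_eq_iff)
    show ?case
      unfolding f_one by (rule generate.one)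
  next
    case (insert j J)
    define f' where "f' = f(j := \<one>\<^bsub>G j\<^esub>)"
    have j: "j \<in> I"
      using insert.prems(1) by simp
    have f: "f i \<in> carrier (G i)" if "i \<in> I" for i
      using insert.prems(2) that by auto
    have f': "f' \<in> carrier ?P"
      using insert.prems(2) j one by (auto simp: f'_def PiE_iff extensional_def)
    have "f' \<in> generate ?P B"
      using insert.prems(1,3) by (intro insert.IH[OF _ f']) (simp_all add: f'_def)
    moreover have "f = e j (f j) \<otimes>\<^bsub>?P\<^esub> f'"
      using insert.prems(2) f one grp j
      by (auto simp: e_def f'_def fun_eq_iff PiE_iff extensional_def group.is_monoid)
    ultimately show ?case
      using generate.eng[OF e_gen[OF j f[OF j]]] by metis
  qed
  from this[OF subset_refl] have "generate ?P B = carrier ?P"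
    using P.generate_incl[OF sub] by blast
  moreover have "finite B"
    using I A(1) by (simp add: B_def)
  ultimately show ?thesis
    unfolding finitely_generated_group_def using P.is_group sub by blast
qed

theorem mainTheorem19:
  fixes G :: "nat \<Rightarrow> ('a, 'b) monoid_scheme" and n :: nat
  assumes "n \<ge> 1"
    and "\<And>i. i < n \<Longrightarrow> finitely_generated_group (G i)"
    and "\<And>i. i < n \<Longrightarrow> non_elementary_virtually_free (G i)"
  shows "R_infinity (product_group {..<n} G)"
proof -
  let ?P = "product_group {..<n} G"
  have grp: "group (G i)" if "i \<in> {..<n}" for i
    using assms(2) that by (simp add: finitely_generated_group_def)
  interpret P: group ?P
    using grp by (rule product_group)
  have n0: "0 \<in> {..<n}"
    using assms(1) by simp
  interpret G0: group "G 0"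
    by (rule grp[OF n0])
  obtain H S a b where H: "subgroup H (G 0)" "finite (rcosets\<^bsub>G 0\<^esub> H)"
    and S: "free_basis ((G 0)\<lparr>carrier := H\<rparr>) S" "a \<in> S" "b \<in> S" "a \<noteq> b"
    using assms(3)[of 0] n0 unfolding non_elementary_virtually_free_def nonabelian_free_subgroup_def by auto
  \<comment> \<open>The preimage of the free subgroup \<open>H\<close> under the projection to the
    factor 0. Its index is finite because cosets of \<open>L\<close> are separated by cosets of
    \<open>H\<close>, and it maps onto \<open>H\<close>.\<close>
  define L where "L = {f \<in> carrier ?P. f 0 \<in> H}"
  have inv: "(inv\<^bsub>?P\<^esub> f) 0 = inv\<^bsub>G 0\<^esub> f 0" if "f \<in> carrier ?P" for f
    using that n0 grp by (subst inv_product_group) auto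
  have mult: "(f \<otimes>\<^bsub>?P\<^esub> g) 0 = f 0 \<otimes>\<^bsub>G 0\<^esub> g 0" for f g
    using n0 by simp
  have proj: "f 0 \<in> carrier (G 0)" if "f \<in> carrier ?P" for f
    using that n0 by auto
  have L: "subgroup L ?P"
  proof
    fix f g assume "f \<in> L" "g \<in> L"
    then show "f \<otimes>\<^bsub>?P\<^esub> g \<in> L"
      using subgroup.m_closed[OF H(1)] P.m_closed mult by (simp add: L_def del: carrier_product_group mult_product_group)
  next
    fix f assume "f \<in> L"
    then show "inv\<^bsub>?P\<^esub> f \<in> L"
      using subgroup.m_inv_closed[OF H(1)] P.inv_closed inv by (simp add: L_def del: carrier_product_group inv_product_group)
  next
    show "\<one>\<^bsub>?P\<^esub> \<in> L"
      using subgroup.one_closed[OF H(1)] P.one_closed n0 by (simp add: L_def del: carrier_product_group)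
  qed (auto simp: L_def)
  have "finite (rcosets\<^bsub>?P\<^esub> L)"
  proof (rule P.finite_rcosetsI[OF L])
    let ?F = "\<lambda>f. H #>\<^bsub>G 0\<^esub> f 0"
    have "?F ` carrier ?P \<subseteq> rcosets\<^bsub>G 0\<^esub> H"
      using G0.rcosetsI[OF subgroup.subset[OF H(1)]] proj by blast
    then show "finite (?F ` carrier ?P)"
      using H(2) finite_subset by blast
    fix f g assume fg: "f \<in> carrier ?P" "g \<in> carrier ?P" "?F f = ?F g"
    then have "f 0 \<otimes>\<^bsub>G 0\<^esub> inv\<^bsub>G 0\<^esub> g 0 \<in> H"
      using G0.rcos_eq_iff[OF H(1) proj proj] by blast
    then show "f \<otimes>\<^bsub>?P\<^esub> inv\<^bsub>?P\<^esub> g \<in> L"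
      using fg P.m_closed[OF fg(1) P.inv_closed[OF fg(2)]] mult inv[OF fg(2)]
      by (simp add: L_def del: carrier_product_group mult_product_group inv_product_group)
  qed
  moreover have "\<exists>\<rho> \<in> hom (?P\<lparr>carrier := L\<rparr>) (alt_group (q + 2)). \<rho> ` L = carrier (alt_group (q + 2))"
    if q: "Factorial_Ring.prime q" "q \<ge> 3" for q
  proof -
    have "odd q"
      using q prime_odd_nat[of q] by auto
    then obtain h where h: "h \<in> hom ((G 0)\<lparr>carrier := H\<rparr>) (alt_group (q + 2))" "h ` H = carrier (alt_group (q + 2))"
      using free_group_onto_alt_group[OF G0.subgroup_imp_group[OF H(1)] S, of "q + 2"] q by auto
    have proj_hom: "(\<lambda>f. h (f 0)) \<in> hom (?P\<lparr>carrier := L\<rparr>) (alt_group (q + 2))"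
      using h(1) mult by (auto simp: hom_def L_def Pi_iff simp del: carrier_product_group mult_product_group)
    have onto: "(\<lambda>f. f 0) ` L = H"
    proof
      show "H \<subseteq> (\<lambda>f. f 0) ` L"
      proof
        fix x assume x: "x \<in> H"
        then have xG: "x \<in> carrier (G 0)"
          using subgroup.mem_carrier[OF H(1)] by blast
        let ?f = "\<one>\<^bsub>?P\<^esub>(0 := x)"
        have "?f \<in> carrier ?P"
          using xG n0 grp by (auto simp: PiE_iff extensional_def group.is_monoid)
        then have "?f \<in> L"
          using x by (simp add: L_def)
        then show "x \<in> (\<lambda>f. f 0) ` L"
          by (rule rev_image_eqI) simp
      qed
    qed (auto simp: L_def)
    have "(\<lambda>f. h (f 0)) ` L = h ` (\<lambda>f. f 0) ` L"
      by (simp only: image_image)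
    then have "(\<lambda>f. h (f 0)) ` L = carrier (alt_group (q + 2))"
      using onto h(2) by (simp only:)
    then show ?thesis
      using proj_hom by (intro bexI[of _ "\<lambda>f. h (f 0)"])
  qed
  ultimately show ?thesis
    using R_infinity_of_alternating_quotients[OF finitely_generated_product_group L] assms(2) by simp
qed

end
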